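(* If $p=p(n)=o(n^{-7/11})$, then the probability that the random graph $\mathcal{G}(n,p)$ contains no triangle is asymptotic, as $n\to\infty$, to $$\exp\left(-\frac16 n^3p^3+\frac14 n^4p^5-\frac{7}{12}n^5p^7+\frac12 n^2p^3-\frac38 n^4p^6+\frac{27}{16}n^6p^9\right).$$
   Context: $\mathcal{G}(n,p)$ is the random graph on $n$ vertices in which each possible edge is present independently with probability $p$. A triangle is a subgraph isomorphic to $K_3$. *)

theory Defs
  imports "HOL-Probability.Probability" "HOL-Library.Landau_Symbols"
begin

text \<open>A finite simple graph is a pair of a vertex set and an edge set, the edges being
  two-element sets of vertices.\<close>

type_synonym 'a graph = "'a set \<times> 'a set set"

definition all_edges :: "'a set \<Rightarrow> 'a set set" where
  "all_edges V = {e. e \<subseteq> V \<and> card e = 2}"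

definition simple_graph :: "'a graph \<Rightarrow> bool" where
  "simple_graph G \<longleftrightarrow> finite (fst G) \<and> snd G \<subseteq> all_edges (fst G)"

definition complete_graph_nat :: "nat \<Rightarrow> nat graph" where
  "complete_graph_nat r = ({..<r}, all_edges {..<r})"

definition subgraph :: "'a graph \<Rightarrow> 'a graph \<Rightarrow> bool" where
  "subgraph H G \<longleftrightarrow> simple_graph H \<and> fst H \<subseteq> fst G \<and> snd H \<subseteq> snd G"

definition graph_iso :: "'a graph \<Rightarrow> 'b graph \<Rightarrow> bool" where
  "graph_iso G H \<longleftrightarrow>
     (\<exists>f. bij_betw f (fst G) (fst H) \<and> snd H = (\<lambda>e. f ` e) ` snd G)"

definition contains_triangle :: "'a graph \<Rightarrow> bool" where
  "contains_triangle G \<longleftrightarrow> (\<exists>H. subgraph H G \<and> graph_iso H (complete_graph_nat 3))"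

definition random_graph :: "nat \<Rightarrow> real \<Rightarrow> nat graph pmf" where
  "random_graph n p =
     map_pmf (\<lambda>f. ({..<n}, {e \<in> all_edges {..<n}. f e}))
       (Pi_pmf (all_edges {..<n}) False (\<lambda>_. bernoulli_pmf p))"

lemma all_edges_triangle:
  assumes "a \<noteq> b" "b \<noteq> c" "a \<noteq> c"
  shows "all_edges {a, b, c} = {{a, b}, {b, c}, {a, c}}"
  using assms unfolding all_edges_def by (auto simp: card_2_iff doubleton_eq_iff)

lemma contains_triangle_iff:
  assumes "simple_graph G"
  shows "contains_triangle G \<longleftrightarrow>
    (\<exists>a b c. a \<noteq> b \<and> b \<noteq> c \<and> a \<noteq> c \<and> {a, b} \<in> snd G \<and> {b, c} \<in> snd G \<and> {a, c} \<in> snd G)"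
proof
  have three: "{..<3::nat} = {0, 1, 2}" by auto
  have K3: "snd (complete_graph_nat 3) = {{0, 1}, {1, 2}, {0, 2}}"
    using all_edges_triangle[of "0::nat" 1 2] by (simp add: complete_graph_nat_def three)
  have V3: "fst (complete_graph_nat 3) = {0, 1, 2}"
    by (simp add: complete_graph_nat_def three)
  {
    assume "contains_triangle G"
    then obtain H and f :: "_ \<Rightarrow> nat" where H: "simple_graph H" "snd H \<subseteq> snd G"
      and bij: "bij_betw f (fst H) {0, 1, 2}"
      and im: "{{0, 1}, {1, 2}, {0, 2}} = (\<lambda>e. f ` e) ` snd H"
      unfolding contains_triangle_def subgraph_def graph_iso_def K3 V3 by metis
    define g where "g = inv_into (fst H) f"
    have inj: "inj_on f (fst H)" using bij by (auto simp: bij_betw_def)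
    have edge: "{g i, g j} \<in> snd G" if "{i, j} \<in> (\<lambda>e. f ` e) ` snd H" for i j
    proof -
      from that obtain e where e: "{i, j} = f ` e" "e \<in> snd H" by (rule imageE)
      then have "e \<subseteq> fst H" using H(1) by (auto simp: simple_graph_def all_edges_def)
      then have "g ` f ` e = e"
        unfolding g_def using inj by (simp add: inv_into_image_cancel)
      moreover have "g ` f ` e = {g i, g j}" unfolding e(1)[symmetric] by simp
      ultimately have "{g i, g j} = e" by simp
      then show ?thesis using e H by auto
    qed
    have "inj_on g {0, 1, 2}"
      unfolding g_def using bij by (metis bij_betw_imp_inj_on bij_betw_inv_into)
    then have "g 0 \<noteq> g 1" "g 1 \<noteq> g 2" "g 0 \<noteq> g 2"
      by (auto simp: inj_on_def)
    moreover have "{g 0, g 1} \<in> snd G" "{g 1, g 2} \<in> snd G" "{g 0, g 2} \<in> snd G"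
      by (rule edge, simp add: im[symmetric])+
    ultimately show "\<exists>a b c. a \<noteq> b \<and> b \<noteq> c \<and> a \<noteq> c \<and>
        {a, b} \<in> snd G \<and> {b, c} \<in> snd G \<and> {a, c} \<in> snd G"
      by blast
  next
    assume "\<exists>a b c. a \<noteq> b \<and> b \<noteq> c \<and> a \<noteq> c \<and>
        {a, b} \<in> snd G \<and> {b, c} \<in> snd G \<and> {a, c} \<in> snd G"
    then obtain a b c where d: "a \<noteq> b" "b \<noteq> c" "a \<noteq> c"
      and e: "{a, b} \<in> snd G" "{b, c} \<in> snd G" "{a, c} \<in> snd G" by blast
    define H where "H = ({a, b, c}, {{a, b}, {b, c}, {a, c}})"
    define f where "f = (\<lambda>x. if x = a then 0 else if x = b then 1 else (2::nat))"
    have "{a, b, c} \<subseteq> fst G"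
      using e assms by (auto simp: simple_graph_def all_edges_def)
    then have "subgraph H G"
      using e d by (simp add: subgraph_def H_def simple_graph_def all_edges_triangle)
    moreover have "graph_iso H (complete_graph_nat 3)"
      unfolding graph_iso_def K3 V3
      by (rule exI[of _ f]) (use d in \<open>auto simp: H_def f_def bij_betw_def inj_on_def\<close>)
    ultimately show "contains_triangle G"
      unfolding contains_triangle_def by blast
  }
qed

end

theory Submission
  imports Defs "HOL-Combinatorics.Transposition"
begin

text \<open>
  Let \<open>Z F\<close> be the probability that \<open>G(n, p) \<union> F\<close> is triangle-free, let \<open>R F = Z F / Z {}\<close>, and put
  \<open>x = n p\<^sup>2\<close>. Since \<open>R\<close> of a single edge does not depend on the edge, Russo's formula gives
  \<open>d/dp ln (Z {}) = - (n choose 2) (1 - R {e}) / (1 - p)\<close>, and it remains to expand \<open>R {e}\<close>.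

  Inclusion-exclusion over the common neighbours of \<open>u\<close> and \<open>v\<close> expresses \<open>R (F \<union> {uv})\<close> as an
  alternating sum of terms \<open>p\<^sup>m R F'\<close>, where \<open>F'\<close> adds to \<open>F\<close> the cherries over \<open>uv\<close> and \<open>m\<close> is the number
  of new edges. As \<open>0 \<le> R \<le> 1\<close>, truncating at \<open>k\<close> common neighbours costs \<open>O(x\<^sup>k)\<close>, so \<open>R\<close> of a fixed
  triangle-free \<open>F\<close> can be expanded to growing order in \<open>x\<close> and \<open>p\<close> by feeding the identity into itself.
  With \<open>r = R {e}\<close> one gets \<open>R (path of length 2) = r\<^sup>2 - p + 4xp + \<dots>\<close> and
  \<open>R (4-cycle) = r\<^sup>4 - 2p + \<dots>\<close>, hence a closed polynomial equation for \<open>r\<close> up to the error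
  \<open>O(x\<^sup>5 + x\<^sup>3p + xp\<^sup>2 + p\<^sup>3)\<close>. Its main part is \<open>r = exp (- x r\<^sup>2)\<close>. Integrating over \<open>p\<close> turns the error into
  \<open>O(n\<^sup>7p\<^sup>1\<^sup>1) + o(1)\<close>, which is where the exponent 7/11 comes from.
\<close>

section \<open>Sums over random subsets\<close>

text \<open>A set of \<open>k\<close> common neighbours carries total weight about
  \<open>x ^ k / fact k\<close>, so the larger the configuration, the less precisely its
  \<open>R\<close> has to be known. For a final error of order x^5 + x^3 p + x p^2 + p^3, the path
  (k = 1) is needed up to x^4 + x^2 p + p^2, the 4-cycle (k = 2) up to x^3 + x p + p^2, three
  cherries up to x^2 + p and four up to x + p. The estimates are obtained in the reverse of this
  order, each one fed by the cruder ones. The obstacle is the vertices on \<open>F\<close>: a cherry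
  over such a vertex may reuse an edge of \<open>F\<close> and then costs p instead of p^2. As
  \<open>F\<close> has boundedly many edges, there are boundedly many such vertices; they produce
  the corrections -p, 4xp and -2p. Expanding \<open>r\<close> inside its own equation would be
  circular. Hence \<open>R (F \<union> {uv})\<close> is compared with the product
  \<open>R F * R {uv}\<close>: the two expansions cancel to leading order, and powers of
  \<open>r\<close> remain in the equation as unknowns.\<close>

definition bern_sum :: "'a set \<Rightarrow> real \<Rightarrow> ('a set \<Rightarrow> real) \<Rightarrow> real" where
  "bern_sum E p g = (\<Sum>S\<in>Pow E. p ^ card S * (1 - p) ^ card (E - S) * g S)"

lemma bern_sum_cong:
  "(\<And>S. S \<subseteq> E \<Longrightarrow> g S = h S) \<Longrightarrow> bern_sum E p g = bern_sum E p h"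
  unfolding bern_sum_def by (rule sum.cong) auto

lemma bern_sum_mono:
  assumes "0 \<le> p" "p \<le> 1" "\<And>S. S \<subseteq> E \<Longrightarrow> g S \<le> h S"
  shows "bern_sum E p g \<le> bern_sum E p h"
  unfolding bern_sum_def using assms by (intro sum_mono mult_left_mono) auto

lemma bern_sum_sum:
  "bern_sum E p (\<lambda>S. \<Sum>i\<in>I. c i * g i S) = (\<Sum>i\<in>I. c i * bern_sum E p (g i))"
proof -
  have "bern_sum E p (\<lambda>S. \<Sum>i\<in>I. c i * g i S) =
      (\<Sum>S\<in>Pow E. \<Sum>i\<in>I. c i * (p ^ card S * (1 - p) ^ card (E - S) * g i S))"
    unfolding bern_sum_def by (intro sum.cong) (auto simp: sum_distrib_left mult_ac)
  also have "\<dots> = (\<Sum>i\<in>I. c i * bern_sum E p (g i))"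
    unfolding bern_sum_def by (subst sum.swap) (simp add: sum_distrib_left)
  finally show ?thesis .
qed

lemma bern_sum_diff:
  "bern_sum E p (\<lambda>S. g S - h S) = bern_sum E p g - bern_sum E p h"
  unfolding bern_sum_def by (simp add: sum_subtractf algebra_simps)

lemma bern_sum_insert:
  assumes "finite E" "a \<notin> E"
  shows "bern_sum (insert a E) p g =
    p * bern_sum E p (\<lambda>S. g (insert a S)) + (1 - p) * bern_sum E p g"
proof -
  have fin: "finite (Pow E)" using assms by simp
  have disj: "Pow E \<inter> insert a ` Pow E = {}" using assms by auto
  have inj: "inj_on (insert a) (Pow E)" using assms by (auto simp: inj_on_def)
  have c1: "card (insert a S) = Suc (card S)" "insert a E - insert a S = E - S"
    "card (insert a E - S) = Suc (card (E - S))" if "S \<subseteq> E" for S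
  proof -
    have "finite S" "a \<notin> S" using that assms finite_subset by auto
    then show "card (insert a S) = Suc (card S)" by simp
    show "insert a E - insert a S = E - S" using \<open>a \<notin> E\<close> by auto
    have "insert a E - S = insert a (E - S)" using \<open>a \<notin> S\<close> by auto
    then show "card (insert a E - S) = Suc (card (E - S))" using assms by simp
  qed
  show ?thesis
    unfolding bern_sum_def Pow_insert
    by (subst sum.union_disjoint)
      (use fin disj inj c1 in \<open>auto simp: sum.reindex sum_distrib_left mult_ac intro!: sum.cong\<close>)
qed

lemma bern_sum_member:
  assumes "finite E" "a \<in> E"
  shows "bern_sum E p (\<lambda>S. of_bool (a \<in> S) * g S) = p * bern_sum E p (\<lambda>S. g (insert a S))"
proof -
  define E' where "E' = E - {a}"
  have E': "E = insert a E'" "finite E'" "a \<notin> E'" using assms by (auto simp: E'_def)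
  have z: "bern_sum E' p (\<lambda>S. of_bool (a \<in> S) * g S) = 0"
    unfolding bern_sum_def using E' by (intro sum.neutral) auto
  show ?thesis unfolding E'(1)
    by (simp add: bern_sum_insert[OF E'(2,3)] z ring_distribs)
qed

lemma bern_sum_superset:
  assumes "finite E" "finite A" "A \<subseteq> E"
  shows "bern_sum E p (\<lambda>S. of_bool (A \<subseteq> S) * g S) = p ^ card A * bern_sum E p (\<lambda>S. g (S \<union> A))"
  using assms(2,3)
proof (induction A arbitrary: g rule: finite_induct)
  case (insert a A)
  have "bern_sum E p (\<lambda>S. of_bool (insert a A \<subseteq> S) * g S)
      = bern_sum E p (\<lambda>S. of_bool (a \<in> S) * (of_bool (A \<subseteq> S) * g S))"
    by (rule bern_sum_cong) auto
  also have "\<dots> = p * bern_sum E p (\<lambda>S. of_bool (A \<subseteq> insert a S) * g (insert a S))"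
    using insert.prems assms(1) by (subst bern_sum_member) auto
  also have "(\<lambda>S. of_bool (A \<subseteq> insert a S) * g (insert a S)) =
      (\<lambda>S. of_bool (A \<subseteq> S) * g (insert a S))"
    using insert.hyps by (auto simp: fun_eq_iff)
  also have "bern_sum E p \<dots> = p ^ card A * bern_sum E p (\<lambda>S. g (insert a (S \<union> A)))"
    using insert by auto
  finally show ?case using insert.hyps by simp
qed simp

text \<open>Edges of \<open>A\<close> that lie in \<open>F\<close> are present anyway, so only those
  of \<open>A - F\<close> have to be drawn and paid for with a factor \<open>p\<close>.\<close>

lemma bern_sum_superset_union:
  assumes "finite E" "A \<subseteq> E"
  shows "bern_sum E p (\<lambda>S. of_bool (A \<subseteq> S \<union> F) * g (S \<union> F)) =
    p ^ card (A - F) * bern_sum E p (\<lambda>S. g (S \<union> (F \<union> A)))"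
proof -
  have "finite (A - F)" using assms finite_subset by auto
  have "(A \<subseteq> S \<union> F) = (A - F \<subseteq> S)" for S by auto
  moreover have "S \<union> (A - F) \<union> F = S \<union> (F \<union> A)" for S by auto
  ultimately show ?thesis
    using bern_sum_superset[OF assms(1) \<open>finite (A - F)\<close>, of p "\<lambda>S. g (S \<union> F)"] assms(2)
    by auto
qed

text \<open>The weight of \<open>S\<close> depends on cardinalities only. This serves to relabel
  vertices.\<close>

lemma bern_sum_image:
  assumes "bij_betw \<phi> E E"
  shows "bern_sum E p (\<lambda>S. g (\<phi> ` S)) = bern_sum E p g"
proof -
  have inj: "inj_on \<phi> E" and im: "\<phi> ` E = E" using assms by (auto simp: bij_betw_def)
  have c: "card (\<phi> ` S) = card S" "card (E - \<phi> ` S) = card (E - S)" if "S \<subseteq> E" for S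
  proof -
    show "card (\<phi> ` S) = card S" using that inj by (meson card_image inj_on_subset)
    have "E - \<phi> ` S = \<phi> ` (E - S)" using that inj im by (simp add: inj_on_image_set_diff)
    then show "card (E - \<phi> ` S) = card (E - S)"
      using inj by (metis card_image inj_on_subset Diff_subset)
  qed
  have "bij_betw ((`) \<phi>) (Pow E) (Pow E)" using assms by (rule bij_betw_Pow)
  then show ?thesis
    unfolding bern_sum_def
    by (subst sum.reindex_bij_betw[symmetric, of "(`) \<phi>" "Pow E"]) (auto simp: c intro!: sum.cong)
qed

text \<open>Russo's formula, for arbitrary \<open>g\<close>. After one element is split off, the sum
  has the form t A(t) + (1 - t) B(t); the product rule yields A - B for that element, and the
  induction hypothesis, applied to two different functions, yields the rest. As
  \<open>bern_sum\<close> is an explicit polynomial in \<open>p\<close>, the derivative is two-sided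
  even at 0 and 1.\<close>

lemma has_derivative_bern_sum:
  assumes "finite E"
  shows "((\<lambda>t. bern_sum E t g) has_real_derivative
    (\<Sum>e\<in>E. bern_sum E t (\<lambda>S. g (insert e S) - g (S - {e})))) (at t)"
  using assms
proof (induction E arbitrary: g rule: finite_induct)
  case empty
  show ?case by (simp add: bern_sum_def)
next
  case (insert a E)
  let ?D = "\<lambda>g. \<Sum>e\<in>E. bern_sum E t (\<lambda>S. g (insert e S) - g (S - {e}))"
  let ?ga = "\<lambda>S. g (insert a S)"
  have "((\<lambda>t. t * bern_sum E t ?ga + (1 - t) * bern_sum E t g) has_real_derivative
      (1 * bern_sum E t ?ga + ?D ?ga * t) + ((0 - 1) * bern_sum E t g + ?D g * (1 - t))) (at t)"
    by (intro DERIV_add DERIV_mult DERIV_diff DERIV_ident DERIV_const insert.IH)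
  moreover have "(\<Sum>e\<in>insert a E. bern_sum (insert a E) t (\<lambda>S. g (insert e S) - g (S - {e}))) =
     (1 * bern_sum E t ?ga + ?D ?ga * t) + ((0 - 1) * bern_sum E t g + ?D g * (1 - t))"
  proof -
    \<comment> \<open>Neither \<open>insert a S\<close> nor \<open>S - {a}\<close> depends on
      whether \<open>a \<in> S\<close>, so both branches give the same value and the weights t and 1
      - t add up to 1.\<close>
    have h1: "bern_sum (insert a E) t (\<lambda>S. g (insert a S) - g (S - {a})) =
        t * bern_sum E t (\<lambda>S. ?ga S - g S) + (1 - t) * bern_sum E t (\<lambda>S. ?ga S - g S)"
      unfolding bern_sum_insert[OF insert.hyps]
      using insert.hyps
      by (intro arg_cong2[where f = "(+)"] arg_cong2[where f = "(*)"] refl bern_sum_cong)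
        (auto simp: subset_insert_iff Diff_insert_absorb intro!: arg_cong[where f = g])
    have h2: "bern_sum (insert a E) t (\<lambda>S. g (insert e S) - g (S - {e})) =
        t * bern_sum E t (\<lambda>S. ?ga (insert e S) - ?ga (S - {e}))
        + (1 - t) * bern_sum E t (\<lambda>S. g (insert e S) - g (S - {e}))" if "e \<in> E" for e
    proof -
      have "a \<noteq> e" using that insert.hyps by auto
      then have "insert a S - {e} = insert a (S - {e})" "insert e (insert a S) = insert a (insert e S)" for S
        by auto
      then show ?thesis unfolding bern_sum_insert[OF insert.hyps] by simp
    qed
    have "(\<Sum>e\<in>E. bern_sum (insert a E) t (\<lambda>S. g (insert e S) - g (S - {e}))) =
        t * ?D ?ga + (1 - t) * ?D g"
      by (simp add: h2 sum.distrib sum_distrib_left)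
    with h1 show ?thesis
      using insert.hyps by (simp add: bern_sum_diff[of E t ?ga g] algebra_simps)
  qed
  ultimately show ?case
    by (simp add: bern_sum_insert[OF insert.hyps])
qed

section \<open>Triangle-free edge sets\<close>

definition triangle_free :: "'a set set \<Rightarrow> bool" where
  "triangle_free S \<longleftrightarrow> \<not> (\<exists>a b c. a \<noteq> b \<and> b \<noteq> c \<and> a \<noteq> c \<and> {a, b} \<in> S \<and> {b, c} \<in> S \<and> {a, c} \<in> S)"

lemma triangle_freeD:
  "triangle_free S \<Longrightarrow> {a, b} \<in> S \<Longrightarrow> {b, c} \<in> S \<Longrightarrow> {a, c} \<in> S \<Longrightarrow> a \<noteq> b \<Longrightarrow> b \<noteq> c \<Longrightarrow> a \<noteq> c \<Longrightarrow> False"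
  unfolding triangle_free_def by blast

lemma triangle_free_subset: "triangle_free T \<Longrightarrow> S \<subseteq> T \<Longrightarrow> triangle_free S"
  unfolding triangle_free_def by blast

lemma triangle_free_empty [simp]: "triangle_free {}"
  by (simp add: triangle_free_def)

lemma triangle_free_image:
  assumes "bij \<pi>"
  shows "triangle_free ((`) \<pi> ` S) \<longleftrightarrow> triangle_free S"
proof -
  have mem: "{\<pi> a, \<pi> b} \<in> (`) \<pi> ` S \<longleftrightarrow> {a, b} \<in> S" for a b
  proof -
    have "{\<pi> a, \<pi> b} = \<pi> ` {a, b}" by simp
    moreover have "inj ((`) \<pi>)" by (rule injI) (simp add: inj_image_eq_iff[OF bij_is_inj[OF assms]])
    ultimately show ?thesis by (simp only: inj_image_mem_iff)
  qed
  have eq: "\<pi> a = \<pi> b \<longleftrightarrow> a = b" for a b using assms by (meson bij_is_inj inj_eq)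
  have surj: "\<exists>b. a = \<pi> b" for a using bij_is_surj[OF assms] by (rule surjD)
  show ?thesis
  proof
    assume *: "triangle_free ((`) \<pi> ` S)"
    show "triangle_free S"
      unfolding triangle_free_def
    proof (intro notI, elim exE conjE)
      fix a b c assume "a \<noteq> b" "b \<noteq> c" "a \<noteq> c" "{a, b} \<in> S" "{b, c} \<in> S" "{a, c} \<in> S"
      then show False using triangle_freeD[OF *, of "\<pi> a" "\<pi> b" "\<pi> c"] by (simp only: mem eq) simp
    qed
  next
    assume *: "triangle_free S"
    show "triangle_free ((`) \<pi> ` S)"
      unfolding triangle_free_def
    proof (intro notI, elim exE conjE)
      fix a b c assume h: "a \<noteq> b" "b \<noteq> c" "a \<noteq> c" "{a, b} \<in> (`) \<pi> ` S" "{b, c} \<in> (`) \<pi> ` S" "{a, c} \<in> (`) \<pi> ` S"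
      obtain a' b' c' where "a = \<pi> a'" "b = \<pi> b'" "c = \<pi> c'" using surj by meson
      with h show False using triangle_freeD[OF *, of a' b' c'] by (simp only: mem eq) simp
    qed
  qed
qed

text \<open>The concrete small graphs used later (edges, paths, 4-cycles) are bipartite, so naming
  one side \<open>A\<close> settles their triangle-freeness.\<close>

lemma triangle_free_bipartite:
  assumes "\<And>a b. {a, b} \<in> F \<Longrightarrow> a \<noteq> b \<Longrightarrow> (a \<in> A) \<noteq> (b \<in> A)"
  shows "triangle_free F"
  unfolding triangle_free_def using assms by blast

lemma finite_all_edges [simp]: "finite V \<Longrightarrow> finite (all_edges V)"
  unfolding all_edges_def by (rule finite_subset[of _ "Pow V"]) auto

lemma card_all_edges: "finite V \<Longrightarrow> card (all_edges V) = card V choose 2"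
  unfolding all_edges_def by (rule n_subsets)

lemma doubleton_in_all_edges [simp]: "{a, b} \<in> all_edges V \<longleftrightarrow> a \<in> V \<and> b \<in> V \<and> a \<noteq> b"
  unfolding all_edges_def by (auto simp: card_insert_if)

lemma prob_triangle_free:
  assumes "0 \<le> p" "p \<le> 1"
  shows "measure_pmf.prob (random_graph n p) {G. \<not> contains_triangle G} =
    bern_sum (all_edges {..<n}) p (\<lambda>S. of_bool (triangle_free S))"
proof -
  define E where "E = all_edges {..<n}"
  have fin: "finite E" by (simp add: E_def)
  let ?P = "Pi_pmf E False (\<lambda>_. bernoulli_pmf p)"
  let ?B = "{S. S \<subseteq> E \<and> triangle_free S}"
  have inj: "inj_on (\<lambda>S e. e \<in> S) A" for A :: "nat set set set"
    by (auto simp: inj_on_def fun_eq_iff)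
  have "measure_pmf.prob (random_graph n p) {G. \<not> contains_triangle G} =
     measure_pmf.prob ?P {f. \<not> contains_triangle ({..<n}, {e \<in> E. f e})}"
    by (simp add: random_graph_def E_def vimage_def)
  also have "\<dots> = measure_pmf.prob ?P {f. triangle_free {e \<in> E. f e}}"
  proof -
    have "simple_graph ({..<n}, {e \<in> E. f e})" for f
      by (auto simp: simple_graph_def E_def)
    then have "\<not> contains_triangle ({..<n}, {e \<in> E. f e}) \<longleftrightarrow> triangle_free {e \<in> E. f e}" for f
      by (subst contains_triangle_iff) (simp_all add: triangle_free_def)
    then show ?thesis by simp
  qed
  also have "\<dots> = measure_pmf.prob ?P ((\<lambda>S e. e \<in> S) ` ?B)"
  \<comment> \<open>Functions that are not the indicator of a subset of \<open>E\<close> are true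
    somewhere outside \<open>E\<close>, where the product measure takes the default
    \<open>False\<close>; they have mass 0.\<close>
  proof (rule measure_prob_cong_0)
    fix f assume f: "f \<in> {f. triangle_free {e \<in> E. f e}} - (\<lambda>S e. e \<in> S) ` ?B"
    have "{e \<in> E. f e} \<in> ?B" using f by auto
    then have "f \<noteq> (\<lambda>e. e \<in> {e \<in> E. f e})" using f image_eqI[of f "\<lambda>S e. e \<in> S" "{e \<in> E. f e}" ?B] by blast
    then show "pmf ?P f = 0" by (intro pmf_Pi_outside[OF fin]) (auto simp: fun_eq_iff)
  next
    fix f assume f: "f \<in> (\<lambda>S e. e \<in> S) ` ?B - {f. triangle_free {e \<in> E. f e}}"
    then obtain S where "S \<subseteq> E" "triangle_free S" "f = (\<lambda>e. e \<in> S)" by auto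
    moreover have "{e \<in> E. e \<in> S} = S" using calculation by auto
    ultimately show "pmf ?P f = 0" using f by auto
  qed
  also have "\<dots> = (\<Sum>S\<in>?B. pmf ?P (\<lambda>e. e \<in> S))"
    using fin inj by (subst measure_measure_pmf_finite) (auto simp: sum.reindex)
  also have "\<dots> = (\<Sum>S\<in>?B. p ^ card S * (1 - p) ^ card (E - S))"
  proof (rule sum.cong)
    fix S assume "S \<in> ?B"
    then have S: "S \<subseteq> E" by simp
    have "pmf ?P (\<lambda>e. e \<in> S) = (\<Prod>e\<in>E. pmf (bernoulli_pmf p) (e \<in> S))"
      using S by (intro pmf_Pi'[OF fin]) auto
    also have "\<dots> = (\<Prod>e\<in>S. pmf (bernoulli_pmf p) (e \<in> S)) * (\<Prod>e\<in>E - S. pmf (bernoulli_pmf p) (e \<in> S))"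
      by (subst prod.subset_diff[OF S fin]) (rule mult.commute)
    also have "\<dots> = p ^ card S * (1 - p) ^ card (E - S)" using assms by simp
    finally show "pmf ?P (\<lambda>e. e \<in> S) = p ^ card S * (1 - p) ^ card (E - S)" .
  qed simp
  also have "\<dots> = bern_sum E p (\<lambda>S. of_bool (triangle_free S))"
    unfolding bern_sum_def using fin
    by (intro sum.mono_neutral_cong_left) auto
  finally show ?thesis by (simp add: E_def)
qed

definition tf_prob :: "nat \<Rightarrow> real \<Rightarrow> nat set set \<Rightarrow> real" where
  "tf_prob n p F = bern_sum (all_edges {..<n}) p (\<lambda>S. of_bool (triangle_free (S \<union> F)))"

lemma tf_prob_nonneg: "0 \<le> p \<Longrightarrow> p \<le> 1 \<Longrightarrow> 0 \<le> tf_prob n p F"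
  unfolding tf_prob_def bern_sum_def by (intro sum_nonneg) auto

lemma tf_prob_antimono: "0 \<le> p \<Longrightarrow> p \<le> 1 \<Longrightarrow> F \<subseteq> F' \<Longrightarrow> tf_prob n p F' \<le> tf_prob n p F"
  unfolding tf_prob_def
  by (intro bern_sum_mono) (auto intro: triangle_free_subset)

lemma tf_prob_empty_pos:
  assumes "0 \<le> p" "p < 1"
  shows "0 < tf_prob n p {}"
proof -
  let ?E = "all_edges {..<n}"
  have "0 < (1 - p) ^ card ?E" using assms by simp
  also have "\<dots> = (\<Sum>S\<in>{{}}. p ^ card S * (1 - p) ^ card (?E - S) * of_bool (triangle_free (S \<union> {})))"
    by simp
  also have "\<dots> \<le> tf_prob n p {}"
    unfolding tf_prob_def bern_sum_def
    by (intro sum_mono2) (use assms in auto)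
  finally show ?thesis .
qed

lemma tf_prob_not_triangle_free: "\<not> triangle_free F \<Longrightarrow> tf_prob n p F = 0"
  unfolding tf_prob_def bern_sum_def
  by (intro sum.neutral) (auto dest: triangle_free_subset)

lemma tf_prob_edge:
  assumes "e \<in> all_edges {..<n}" "e' \<in> all_edges {..<n}"
  shows "tf_prob n p {e} = tf_prob n p {e'}"
proof -
  obtain u v where e: "e = {u, v}" "u \<noteq> v" "u < n" "v < n"
    using assms(1) by (auto simp: all_edges_def card_2_iff)
  obtain u' v' where e': "e' = {u', v'}" "u' \<noteq> v'" "u' < n" "v' < n"
    using assms(2) by (auto simp: all_edges_def card_2_iff)
  \<comment> \<open>The first transposition moves \<open>u\<close> to \<open>u'\<close> and
    \<open>v\<close> to \<open>y\<close>. The second one moves \<open>y\<close> to \<open>v'\<close>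
    and leaves \<open>u'\<close> alone, because \<open>u'\<close> differs from both \<open>y\<close>
    and \<open>v'\<close>.\<close>
  define y where "y = Transposition.transpose u u' v"
  have y: "y < n" "y \<noteq> u'" using e e' by (auto simp: y_def Transposition.transpose_def)
  define \<pi> where "\<pi> = Transposition.transpose y v' \<circ> Transposition.transpose u u'"
  have \<pi>: "bij \<pi>" by (simp add: \<pi>_def bij_comp)
  have "\<pi> u = u'" "\<pi> v = v'"
    using e e' y unfolding \<pi>_def comp_def y_def[symmetric] by (auto simp: Transposition.transpose_def)
  then have im: "\<pi> ` e = e'" using e e' by simp
  have lt: "\<pi> z < n \<longleftrightarrow> z < n" for z
    using e e' y by (auto simp: \<pi>_def Transposition.transpose_def)
  have "bij_betw ((`) \<pi>) (all_edges {..<n}) (all_edges {..<n})"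
  proof (rule bij_betwI[where g = "(`) (inv \<pi>)"])
    have inj: "inj \<pi>" using \<pi> by (rule bij_is_inj)
    show "(`) \<pi> \<in> all_edges {..<n} \<rightarrow> all_edges {..<n}"
      using lt inj by (auto simp: all_edges_def card_image inj_on_subset)
    have "inv \<pi> z < n \<longleftrightarrow> z < n" for z
      by (metis \<pi> bij_inv_eq_iff lt)
    then show "(`) (inv \<pi>) \<in> all_edges {..<n} \<rightarrow> all_edges {..<n}"
      using card_image[OF inj_on_subset[OF bij_is_inj[OF bij_imp_bij_inv[OF \<pi>]]]]
      by (auto simp: all_edges_def)
    show "inv \<pi> ` \<pi> ` x = x" "\<pi> ` inv \<pi> ` x = x" for x
      using \<pi> by (simp_all add: image_inv_f_f image_f_inv_f bij_is_inj bij_is_surj)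
  qed
  from bern_sum_image[OF this, of p "\<lambda>S. of_bool (triangle_free (S \<union> {e'}))"]
  have "tf_prob n p {e'} =
    bern_sum (all_edges {..<n}) p (\<lambda>S. of_bool (triangle_free ((`) \<pi> ` (S \<union> {e}))))"
    by (simp add: tf_prob_def im)
  then show ?thesis unfolding triangle_free_image[OF \<pi>] by (simp only: tf_prob_def)
qed

section \<open>Common neighbours of an edge, and Russo's formula for triangle-freeness\<close>

definition cherries :: "'a \<Rightarrow> 'a \<Rightarrow> 'a set \<Rightarrow> 'a set set" where
  "cherries u v W = (\<Union>w\<in>W. {{u, w}, {v, w}})"

text \<open>A triangle through the new edge is a cherry over it;
  \<open>X \<subseteq> all_edges V\<close> forces the third vertex into \<open>V - {u, v}\<close>,
  which makes the quantifier finite.\<close>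

lemma triangle_free_insert_edge:
  assumes "u \<noteq> v" "X \<subseteq> all_edges V" "u \<in> V" "v \<in> V"
  shows "triangle_free (insert {u, v} X) \<longleftrightarrow>
    triangle_free X \<and> (\<forall>w\<in>V - {u, v}. \<not> {{u, w}, {v, w}} \<subseteq> X)"
proof (intro iffI conjI ballI)
  assume *: "triangle_free (insert {u, v} X)"
  show "triangle_free X" using * by (rule triangle_free_subset) auto
  fix w assume w: "w \<in> V - {u, v}"
  show "\<not> {{u, w}, {v, w}} \<subseteq> X"
    using triangle_freeD[OF *, of u v w] w \<open>u \<noteq> v\<close> by auto
next
  assume *: "triangle_free X \<and> (\<forall>w\<in>V - {u, v}. \<not> {{u, w}, {v, w}} \<subseteq> X)"
  show "triangle_free (insert {u, v} X)"
    unfolding triangle_free_def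
  proof (intro notI, elim exE conjE)
    fix a b c assume d: "a \<noteq> b" "b \<noteq> c" "a \<noteq> c"
      and h: "{a, b} \<in> insert {u, v} X" "{b, c} \<in> insert {u, v} X" "{a, c} \<in> insert {u, v} X"
    have inV: "x \<in> V" "y \<in> V" if "{x, y} \<in> insert {u, v} X" for x y
      using that assms doubleton_in_all_edges[of x y V] by (auto simp: doubleton_eq_iff)
    have key: False if "{x, y} = {u, v}" "{x, z} \<in> insert {u, v} X" "{y, z} \<in> insert {u, v} X"
      "x \<noteq> z" "y \<noteq> z" for x y z
    proof -
      have "z \<in> V - {u, v}" using inV[of x z] that by (auto simp: doubleton_eq_iff)
      moreover have "{{u, z}, {v, z}} \<subseteq> X" using that by (auto simp: doubleton_eq_iff)
      ultimately show False using * by blast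
    qed
    show False
    proof (cases "{a, b} = {u, v} \<or> {b, c} = {u, v} \<or> {a, c} = {u, v}")
      case True
      then show ?thesis using key[of a b c] key[of b c a] key[of a c b] h d
        by (auto simp: insert_commute)
    next
      case False
      then show ?thesis using * h d triangle_freeD[of X a b c] by auto
    qed
  qed
qed

lemma cherries_subset: "u \<in> V \<Longrightarrow> v \<in> V \<Longrightarrow> W \<subseteq> V - {u, v} \<Longrightarrow> cherries u v W \<subseteq> all_edges V"
  unfolding cherries_def by auto

text \<open>Inclusion-exclusion over the common neighbours of \<open>u\<close> and \<open>v\<close>.\<close>

lemma tf_prob_insert_edge:
  assumes uv: "u \<noteq> v" "u < n" "v < n" and F: "F \<subseteq> all_edges {..<n}"
  shows "tf_prob n p (insert {u, v} F) =
    (\<Sum>W\<in>Pow ({..<n} - {u, v}). (-1) ^ card W * (p ^ card (cherries u v W - F) * tf_prob n p (F \<union> cherries u v W)))"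
proof -
  let ?E = "all_edges {..<n}" and ?U = "{..<n} - {u, v}"
  \<comment> \<open>The indicator that no \<open>w\<close> closes a triangle is a product of factors
    1 - [cherry over \<open>w\<close> present]; multiplying it out gives the alternating sum over
    \<open>W\<close>.\<close>
  have pt: "(of_bool (triangle_free (S \<union> insert {u, v} F)) :: real) =
    (\<Sum>W\<in>Pow ?U. (-1) ^ card W *
      (of_bool (cherries u v W \<subseteq> S \<union> F) * of_bool (triangle_free (S \<union> F))))" (is "?L = ?R")
    if "S \<subseteq> ?E" for S :: "nat set set"
  proof -
    let ?X = "S \<union> F"
    have "?L = of_bool (triangle_free ?X) * (\<Prod>w\<in>?U. 1 - of_bool ({{u, w}, {v, w}} \<subseteq> ?X) :: real)"
    proof (cases "\<exists>w\<in>?U. {{u, w}, {v, w}} \<subseteq> ?X")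
      case True
      then have "(\<Prod>w\<in>?U. 1 - of_bool ({{u, w}, {v, w}} \<subseteq> ?X) :: real) = 0"
        by (intro prod_zero) auto
      moreover have "\<not> triangle_free (S \<union> insert {u, v} F)"
        using triangle_free_insert_edge[of u v ?X "{..<n}"] that F uv True by auto
      ultimately show ?thesis by simp
    next
      case False
      then have "(\<Prod>w\<in>?U. 1 - of_bool ({{u, w}, {v, w}} \<subseteq> ?X) :: real) = 1"
        by (intro prod.neutral) auto
      moreover have "triangle_free (S \<union> insert {u, v} F) \<longleftrightarrow> triangle_free ?X"
        using triangle_free_insert_edge[of u v ?X "{..<n}"] that F uv False by auto
      ultimately show ?thesis by simp
    qed
    also have "(\<Prod>w\<in>?U. 1 - of_bool ({{u, w}, {v, w}} \<subseteq> ?X) :: real) =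
        (\<Sum>W\<in>Pow ?U. (-1) ^ card W * of_bool (cherries u v W \<subseteq> ?X))"
    proof -
      have "(\<Prod>w\<in>W. of_bool ({{u, w}, {v, w}} \<subseteq> ?X) :: real) = of_bool (cherries u v W \<subseteq> ?X)"
        if "W \<in> Pow ?U" for W
      proof -
        have "finite W" using that finite_subset by auto
        then show ?thesis by (induction W rule: finite_induct) (auto simp: cherries_def)
      qed
      then show ?thesis
        by (subst prod_diff_conv_sum) (auto intro!: sum.cong)
    qed
    finally show ?thesis by (simp add: sum_distrib_left mult_ac)
  qed
  have "tf_prob n p (insert {u, v} F) = (\<Sum>W\<in>Pow ?U. (-1) ^ card W *
      bern_sum ?E p (\<lambda>S. of_bool (cherries u v W \<subseteq> S \<union> F) * of_bool (triangle_free (S \<union> F))))"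
    unfolding tf_prob_def bern_sum_sum[symmetric] by (rule bern_sum_cong) (rule pt)
  also have "\<dots> = (\<Sum>W\<in>Pow ?U. (-1) ^ card W * (p ^ card (cherries u v W - F) * tf_prob n p (F \<union> cherries u v W)))"
    by (intro sum.cong refl arg_cong2[where f = "(*)"])
      (use cherries_subset[of u "{..<n}" v] uv in
        \<open>auto simp: tf_prob_def intro!: bern_sum_superset_union[where g = "\<lambda>S. of_bool (triangle_free S)"]\<close>)
  finally show ?thesis .
qed

text \<open>Russo's formula contrasts an edge being present with its being absent.
  \<open>Z {}\<close> is the mixture of these two cases with weights t and 1 - t, so the contrast
  equals \<open>(Z {e} - Z {}) / (1 - t)\<close>. By \<open>tf_prob_edge\<close> every edge
  contributes the same amount.\<close>

lemma has_derivative_tf_prob: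
  assumes "t < 1" "e \<in> all_edges {..<n}"
  shows "((\<lambda>t. tf_prob n t {}) has_real_derivative
    real (n choose 2) * (tf_prob n t {e} - tf_prob n t {}) / (1 - t)) (at t)"
proof -
  let ?E = "all_edges {..<n}"
  let ?g = "\<lambda>S. of_bool (triangle_free S) :: real"
  have fin: "finite ?E" by simp
  have eq: "bern_sum ?E t (\<lambda>S. ?g (insert a S) - ?g (S - {a})) = (tf_prob n t {e} - tf_prob n t {}) / (1 - t)"
    if "a \<in> ?E" for a
  proof -
    define E' where "E' = ?E - {a}"
    have E': "?E = insert a E'" "finite E'" "a \<notin> E'" using that fin by (auto simp: E'_def)
    have S: "S - {a} = S" "insert a S - {a} = S" if "S \<subseteq> E'" for S using that E' by auto
    have c: "bern_sum E' t (\<lambda>S. ?g (S - {a})) = bern_sum E' t ?g"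
      by (intro bern_sum_cong) (simp only: S)
    have c': "bern_sum E' t (\<lambda>S. ?g (insert a S - {a})) = bern_sum E' t ?g"
      by (intro bern_sum_cong) (simp only: S)
    have "tf_prob n t {e} = tf_prob n t {a}" using assms(2) that by (rule tf_prob_edge)
    also have "\<dots> = bern_sum E' t (\<lambda>S. ?g (insert a S))"
      by (simp add: tf_prob_def E'(1) bern_sum_insert[OF E'(2,3)] algebra_simps)
    finally have 1: "tf_prob n t {e} = bern_sum E' t (\<lambda>S. ?g (insert a S))" .
    have 2: "tf_prob n t {} = t * bern_sum E' t (\<lambda>S. ?g (insert a S)) + (1 - t) * bern_sum E' t ?g"
      by (simp add: tf_prob_def E'(1) bern_sum_insert[OF E'(2,3)])
    have "bern_sum ?E t (\<lambda>S. ?g (insert a S) - ?g (S - {a})) =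
      bern_sum E' t (\<lambda>S. ?g (insert a S)) - bern_sum E' t ?g"
      unfolding bern_sum_diff by (simp add: E'(1) bern_sum_insert[OF E'(2,3)] c c' algebra_simps)
    moreover have "tf_prob n t {e} - tf_prob n t {} =
      (1 - t) * (bern_sum E' t (\<lambda>S. ?g (insert a S)) - bern_sum E' t ?g)"
      unfolding 1 2 by (simp add: algebra_simps)
    ultimately show ?thesis using assms(1) by simp
  qed
  show ?thesis
    using has_derivative_bern_sum[OF fin, of ?g t]
    by (simp add: tf_prob_def[of n _ "{}"] eq card_all_edges)
qed

section \<open>Sums over subsets of bounded size\<close>

definition subsets_card :: "'a set \<Rightarrow> nat \<Rightarrow> 'a set set" where
  "subsets_card U k = {W. W \<subseteq> U \<and> card W = k}"

definition subsets_ge :: "'a set \<Rightarrow> nat \<Rightarrow> 'a set set" where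
  "subsets_ge U k = {W. W \<subseteq> U \<and> k \<le> card W}"

lemma finite_subsets_card [simp]: "finite U \<Longrightarrow> finite (subsets_card U k)"
  unfolding subsets_card_def by (rule finite_subset[of _ "Pow U"]) auto

lemma finite_subsets_ge [simp]: "finite U \<Longrightarrow> finite (subsets_ge U k)"
  unfolding subsets_ge_def by (rule finite_subset[of _ "Pow U"]) auto

lemma subsets_card_0: "finite U \<Longrightarrow> subsets_card U 0 = {{}}"
  unfolding subsets_card_def by (auto dest: finite_subset)

lemma card_subsets_card: "finite U \<Longrightarrow> card (subsets_card U k) = card U choose k"
  unfolding subsets_card_def by (rule n_subsets)

lemma sum_Pow_split:
  fixes h :: "'a set \<Rightarrow> real"
  assumes "finite U"
  shows "(\<Sum>W\<in>Pow U. h W) = (\<Sum>k<K. \<Sum>W\<in>subsets_card U k. h W) + (\<Sum>W\<in>subsets_ge U K. h W)"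
proof -
  have "Pow U = (\<Union>k\<in>{..<K}. subsets_card U k) \<union> subsets_ge U K"
    by (auto simp: subsets_card_def subsets_ge_def)
  also have "sum h \<dots> = sum h (\<Union>k\<in>{..<K}. subsets_card U k) + sum h (subsets_ge U K)"
    using assms by (intro sum.union_disjoint) (auto simp: subsets_card_def subsets_ge_def)
  also have "sum h (\<Union>k\<in>{..<K}. subsets_card U k) = (\<Sum>k<K. sum h (subsets_card U k))"
    using assms by (intro sum.UNION_disjoint) (auto simp: subsets_card_def)
  finally show ?thesis .
qed

lemma sum_Pow_insert:
  fixes h :: "'a set \<Rightarrow> real"
  assumes "finite U" "a \<notin> U"
  shows "(\<Sum>W\<in>Pow (insert a U). h W) = (\<Sum>W\<in>Pow U. h W) + (\<Sum>W\<in>Pow U. h (insert a W))"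
proof -
  have "inj_on (insert a) (Pow U)" using assms by (auto simp: inj_on_def)
  then show ?thesis unfolding Pow_insert
    by (subst sum.union_disjoint) (use assms in \<open>auto simp: sum.reindex\<close>)
qed

text \<open>Deleting from \<open>W\<close> one of its points in \<open>N\<close>.\<close>

lemma sum_prod_subsets_hit:
  fixes q :: "'a \<Rightarrow> real"
  assumes "finite U" "N \<subseteq> U" "\<And>w. w \<in> U \<Longrightarrow> 0 \<le> q w"
  shows "(\<Sum>W\<in>{W \<in> subsets_ge U (Suc K). W \<inter> N \<noteq> {}}. \<Prod>w\<in>W. q w) \<le>
    (\<Sum>w\<in>N. q w) * (\<Sum>W\<in>subsets_ge U K. \<Prod>w\<in>W. q w)"
proof -
  let ?D = "Sigma N (\<lambda>w. subsets_ge (U - {w}) K)"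
  \<comment> \<open>This map is not injective, but it covers the index set on the left; overcounting
    is harmless as all terms are nonnegative.\<close>
  let ?g = "\<lambda>(w, W). insert w W"
  have fN: "finite N" using finite_subset[OF assms(2,1)] .
  have fD: "finite ?D" using fN assms by auto
  have nn: "0 \<le> (\<Prod>w\<in>W. q w)" if "W \<subseteq> U" for W using that assms by (intro prod_nonneg) auto
  have sub: "{W \<in> subsets_ge U (Suc K). W \<inter> N \<noteq> {}} \<subseteq> ?g ` ?D"
  proof
    fix W assume "W \<in> {W \<in> subsets_ge U (Suc K). W \<inter> N \<noteq> {}}"
    then obtain w where w: "W \<subseteq> U" "Suc K \<le> card W" "w \<in> W" "w \<in> N"
      by (auto simp: subsets_ge_def)
    have "finite W" using finite_subset[OF w(1) assms(1)] .
    then have "K \<le> card (W - {w})" using w by simp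
    then have "(w, W - {w}) \<in> ?D" using w by (auto simp: subsets_ge_def)
    moreover have "W = ?g (w, W - {w})" using w by auto
    ultimately show "W \<in> ?g ` ?D" by blast
  qed
  have im: "W \<subseteq> U" if "W \<in> ?g ` ?D" for W using that assms(2) by (auto simp: subsets_ge_def)
  have "(\<Sum>W\<in>{W \<in> subsets_ge U (Suc K). W \<inter> N \<noteq> {}}. \<Prod>w\<in>W. q w) \<le> (\<Sum>W\<in>?g ` ?D. \<Prod>w\<in>W. q w)"
    using sub fD nn im by (intro sum_mono2) auto
  also have "\<dots> \<le> (\<Sum>z\<in>?D. \<Prod>w\<in>?g z. q w)"
    using sum_image_le[OF fD, of "\<lambda>W. \<Prod>w\<in>W. q w" ?g] nn im by (auto simp: comp_def)
  also have "\<dots> = (\<Sum>w\<in>N. \<Sum>W\<in>subsets_ge (U - {w}) K. q w * (\<Prod>w\<in>W. q w))"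
  proof -
    have "(\<Prod>a\<in>insert w W. q a) = q w * (\<Prod>a\<in>W. q a)" if "W \<in> subsets_ge (U - {w}) K" for w W
    proof -
      have "finite W" "w \<notin> W" using that assms(1) by (auto simp: subsets_ge_def intro: finite_subset)
      then show ?thesis by simp
    qed
    then show ?thesis
      using fN assms by (subst sum.Sigma) (auto intro!: sum.cong)
  qed
  also have "\<dots> \<le> (\<Sum>w\<in>N. \<Sum>W\<in>subsets_ge U K. q w * (\<Prod>w\<in>W. q w))"
    using assms by (intro sum_mono sum_mono2) (auto simp: subsets_ge_def intro!: mult_nonneg_nonneg nn)
  also have "\<dots> = (\<Sum>w\<in>N. q w) * (\<Sum>W\<in>subsets_ge U K. \<Prod>w\<in>W. q w)"
    by (simp add: sum_product)
  finally show ?thesis .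
qed

text \<open>For K = 0 the sum is the product of all 1 + q w, at most exp (1/2) and so at most 2.
  Each further guaranteed element costs one factor: \<open>sum_prod_subsets_hit\<close> with
  \<open>N = U\<close>.\<close>

lemma sum_prod_subsets_ge:
  fixes q :: "'a \<Rightarrow> real"
  assumes "finite U" "\<And>w. w \<in> U \<Longrightarrow> 0 \<le> q w" "(\<Sum>w\<in>U. q w) \<le> 1 / 2"
  shows "(\<Sum>W\<in>subsets_ge U K. \<Prod>w\<in>W. q w) \<le> 2 * (\<Sum>w\<in>U. q w) ^ K"
proof (induction K)
  case 0
  have "(\<Sum>W\<in>subsets_ge U 0. \<Prod>w\<in>W. q w) = (\<Prod>w\<in>U. q w + 1)"
    using assms(1) by (subst prod_add) (auto simp: subsets_ge_def Pow_def)
  also have "\<dots> \<le> (\<Prod>w\<in>U. exp (q w))"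
    using assms by (intro prod_mono) (auto simp: add.commute intro: add_nonneg_nonneg)
  also have "\<dots> = exp (\<Sum>w\<in>U. q w)" using assms(1) by (simp add: exp_sum)
  also have "\<dots> \<le> exp (1 / 2)" using assms(3) by simp
  also have "\<dots> \<le> 2"
  proof -
    have "exp (1 / 2 :: real) ^ 2 = exp 1" by (simp flip: exp_of_nat_mult)
    also have "\<dots> \<le> 3" by (rule exp_le)
    also have "\<dots> \<le> 2 ^ 2" by simp
    finally show ?thesis by (rule power2_le_imp_le) simp
  qed
  finally show ?case by simp
next
  case (Suc K)
  have "(\<Sum>W\<in>subsets_ge U (Suc K). \<Prod>w\<in>W. q w) =
      (\<Sum>W\<in>{W \<in> subsets_ge U (Suc K). W \<inter> U \<noteq> {}}. \<Prod>w\<in>W. q w)"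
    by (rule sum.cong) (auto simp: subsets_ge_def Int_absorb2)
  also have "\<dots> \<le> (\<Sum>w\<in>U. q w) * (\<Sum>W\<in>subsets_ge U K. \<Prod>w\<in>W. q w)"
    using assms by (intro sum_prod_subsets_hit) auto
  also have "\<dots> \<le> (\<Sum>w\<in>U. q w) * (2 * (\<Sum>w\<in>U. q w) ^ K)"
    using Suc assms by (intro mult_left_mono sum_nonneg) auto
  finally show ?case by simp
qed

text \<open>The vertices of \<open>W\<close> are off \<open>F\<close>, so their only neighbours are
  \<open>u\<close> and \<open>v\<close>, which are not adjacent. Hence no triangle meets
  \<open>W\<close>.\<close>

lemma triangle_free_cherries:
  assumes "triangle_free F" "{u, v} \<notin> F" "W \<inter> \<Union>F = {}" "u \<notin> W" "v \<notin> W" "u \<noteq> v"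
  shows "triangle_free (F \<union> cherries u v W)"
  unfolding triangle_free_def
proof (intro notI, elim exE conjE)
  fix a b c assume d: "a \<noteq> b" "b \<noteq> c" "a \<noteq> c"
    and h: "{a, b} \<in> F \<union> cherries u v W" "{b, c} \<in> F \<union> cherries u v W" "{a, c} \<in> F \<union> cherries u v W"
  have inW: "y = u \<or> y = v" if "{x, y} \<in> F \<union> cherries u v W" "x \<in> W" for x y
    using that assms by (auto simp: cherries_def doubleton_eq_iff)
  have key: False if "x \<in> W" "{x, y} \<in> F \<union> cherries u v W" "{x, z} \<in> F \<union> cherries u v W"
    "{y, z} \<in> F \<union> cherries u v W" "y \<noteq> z" for x y z
  proof -
    have "{y, z} = {u, v}" using inW[of x y] inW[of x z] that by auto
    then have "{u, v} \<in> F \<union> cherries u v W" using that(4) by simp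
    then show False using assms by (auto simp: cherries_def doubleton_eq_iff)
  qed
  have out: "{x, y} \<in> F" if "{x, y} \<in> F \<union> cherries u v W" "x \<notin> W" "y \<notin> W" for x y
    using that by (auto simp: cherries_def doubleton_eq_iff)
  have h': "{b, a} \<in> F \<union> cherries u v W" "{c, b} \<in> F \<union> cherries u v W" "{c, a} \<in> F \<union> cherries u v W"
    using h by (simp_all only: insert_commute)
  have "a \<notin> W" "b \<notin> W" "c \<notin> W"
    using key[OF _ h(1) h(3) h(2) d(2)] key[OF _ h'(1) h(2) h(3) d(3)] key[OF _ h'(3,2) h(1) d(1)] by blast+
  then have "{a, b} \<in> F" "{b, c} \<in> F" "{a, c} \<in> F" using out h by blast+
  then show False using triangle_freeD[OF assms(1)] d by blast
qed

lemma cherries_insert: "cherries u v (insert w W) = {{u, w}, {v, w}} \<union> cherries u v W"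
  by (auto simp: cherries_def)

lemma cherries_empty [simp]: "cherries u v {} = {}"
  by (simp add: cherries_def)

lemma finite_cherries [simp]: "finite W \<Longrightarrow> finite (cherries u v W)"
  by (simp add: cherries_def)

lemma card_cherries_le: "finite W \<Longrightarrow> card (cherries u v W) \<le> 2 * card W"
proof (induction W rule: finite_induct)
  case (insert w W)
  have "card (cherries u v (insert w W)) \<le> card {{u, w}, {v, w}} + card (cherries u v W)"
    unfolding cherries_insert by (rule card_Un_le)
  also have "card {{u, w}, {v, w}} \<le> 2" by (simp add: card_insert_if)
  finally show ?case using insert by simp
qed simp

lemma card_cherries:
  assumes "finite W" "u \<noteq> v" "u \<notin> W" "v \<notin> W"
  shows "card (cherries u v W) = 2 * card W"
  using assms
proof (induction W rule: finite_induct)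
  case (insert w W)
  have "{{u, w}, {v, w}} \<inter> cherries u v W = {}"
    using insert by (auto simp: cherries_def doubleton_eq_iff)
  moreover have "card {{u, w}, {v, w}} = 2"
    using insert.prems by (subst card_2_iff) (auto simp: doubleton_eq_iff)
  ultimately show ?case
    unfolding cherries_insert using insert by (subst card_Un_disjoint) auto
qed simp

text \<open>Cherries over different vertices are edge-disjoint, so the weight of \<open>W\<close>
  factors over its elements.\<close>

lemma power_card_cherries_diff:
  fixes p :: real
  assumes "finite W" "u \<noteq> v" "u \<notin> W" "v \<notin> W"
  shows "p ^ card (cherries u v W - F) = (\<Prod>w\<in>W. p ^ card ({{u, w}, {v, w}} - F))"
  using assms
proof (induction W rule: finite_induct)
  case (insert w W)
  have "cherries u v (insert w W) - F = ({{u, w}, {v, w}} - F) \<union> (cherries u v W - F)"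
    unfolding cherries_insert by (rule Un_Diff)
  moreover have "{{u, w}, {v, w}} \<inter> cherries u v W = {}"
    using insert by (auto simp: cherries_def doubleton_eq_iff)
  then have "({{u, w}, {v, w}} - F) \<inter> (cherries u v W - F) = {}" by blast
  ultimately have "card (cherries u v (insert w W) - F) =
      card ({{u, w}, {v, w}} - F) + card (cherries u v W - F)"
    using insert.hyps(1) card_Un_disjoint[of "{{u, w}, {v, w}} - F" "cherries u v W - F"] by simp
  then show ?case using insert by (simp add: power_add)
qed simp

section \<open>Local expansions\<close>

text \<open>The bounds 1/100 keep \<open>x + 18 * p\<close> below 1/2, so that sums over vertex sets
  behave like geometric series, and they later make the fixed-point map of the edge equation a
  contraction. For p = o(n^(-7/11)) they hold for all large n.\<close>

locale sparse =
  fixes n :: nat and p :: real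
  assumes p_nonneg: "0 \<le> p" and p_small: "p \<le> 1 / 100" and np_small: "real n * p\<^sup>2 \<le> 1 / 100"
begin

definition x :: real where "x = real n * p\<^sup>2"

text \<open>For \<open>F \<subseteq> E\<close>, \<open>p ^ card F * R F\<close> is the conditional
  probability that the random graph contains \<open>F\<close>, given that it is
  triangle-free.\<close>

definition R :: "nat set set \<Rightarrow> real" where "R F = tf_prob n p F / tf_prob n p {}"

text \<open>The price of the cherry over \<open>w\<close>: p^2 for \<open>w\<close> off
  \<open>F\<close> (a generic vertex), p if one of its two edges is already in
  \<open>F\<close>.\<close>

definition q :: "nat set set \<Rightarrow> nat \<Rightarrow> nat \<Rightarrow> nat \<Rightarrow> real" where
  "q F u v w = p ^ card ({{u, w}, {v, w}} - F)"

abbreviation "V \<equiv> {..<n}"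
abbreviation "E \<equiv> all_edges {..<n}"

lemma x_nonneg: "0 \<le> x" and x_small: "x \<le> 1 / 100"
  using np_small by (auto simp: x_def)

lemma R_nonneg: "0 \<le> R F"
  unfolding R_def using p_nonneg p_small by (intro divide_nonneg_nonneg tf_prob_nonneg) auto

lemma R_le_1: "R F \<le> 1"
  unfolding R_def using p_nonneg p_small tf_prob_empty_pos[of p n] tf_prob_antimono[of p "{}" F n]
  by (simp add: divide_le_eq_1)

lemma R_empty [simp]: "R {} = 1"
  unfolding R_def using p_nonneg p_small tf_prob_empty_pos[of p n] by simp

lemma R_not_triangle_free: "\<not> triangle_free F \<Longrightarrow> R F = 0"
  by (simp add: R_def tf_prob_not_triangle_free)

lemma R_edge: "e \<in> E \<Longrightarrow> e' \<in> E \<Longrightarrow> R {e} = R {e'}"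
  using tf_prob_edge[of e n e' p] by (simp add: R_def)

lemma q_nonneg: "0 \<le> q F u v w"
  using p_nonneg by (simp add: q_def)

lemma p2_le_q: "p\<^sup>2 \<le> q F u v w"
proof -
  have "card ({{u, w}, {v, w}} - F) \<le> card {{u, w}, {v, w}}" by (rule card_mono) auto
  also have "\<dots> \<le> 2" by (simp add: card_insert_if)
  finally show ?thesis unfolding q_def using p_nonneg p_small by (intro power_decreasing) auto
qed

lemma R_insert_edge:
  assumes "u \<noteq> v" "u < n" "v < n" "F \<subseteq> E"
  shows "R (insert {u, v} F) =
    (\<Sum>W\<in>Pow (V - {u, v}). (-1) ^ card W * ((\<Prod>w\<in>W. q F u v w) * R (F \<union> cherries u v W)))"
  unfolding R_def tf_prob_insert_edge[OF assms] sum_divide_distrib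
proof (rule sum.cong[OF refl])
  fix W assume W: "W \<in> Pow (V - {u, v})"
  have "finite W" using W by (auto intro: finite_subset)
  then have "p ^ card (cherries u v W - F) = (\<Prod>w\<in>W. q F u v w)"
    using power_card_cherries_diff[of W u v p F] W assms(1) by (auto simp: q_def)
  then show "(-1) ^ card W * (p ^ card (cherries u v W - F) * tf_prob n p (F \<union> cherries u v W)) / tf_prob n p {}
    = (-1) ^ card W * ((\<Prod>w\<in>W. q F u v w) * (tf_prob n p (F \<union> cherries u v W) / tf_prob n p {}))"
    by simp
qed

lemma q_generic:
  assumes "u \<noteq> v" "w \<noteq> u" "w \<noteq> v" "w \<notin> \<Union>F"
  shows "q F u v w = p\<^sup>2"
proof -
  have "{{u, w}, {v, w}} - F = {{u, w}, {v, w}}" using assms by auto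
  moreover have "card {{u, w}, {v, w}} = 2"
    using assms by (subst card_2_iff) (auto simp: doubleton_eq_iff)
  ultimately show ?thesis by (simp add: q_def)
qed

lemma q_le:
  assumes "triangle_free (insert {u, v} F)" "u \<noteq> v" "w \<noteq> u" "w \<noteq> v"
  shows "q F u v w \<le> p"
proof -
  have "{{u, w}, {v, w}} - F \<noteq> {}"
    using triangle_freeD[OF assms(1), of u v w] assms by auto
  then have "1 \<le> card ({{u, w}, {v, w}} - F)"
    by (simp add: Suc_le_eq card_gt_0_iff)
  then have "q F u v w \<le> p ^ 1"
    unfolding q_def using p_nonneg p_small by (intro power_decreasing) auto
  then show ?thesis by simp
qed

lemma sum_Pow_truncate:
  assumes "finite G" "card G \<le> n" "0 \<le> c" "\<And>W. W \<subseteq> G \<Longrightarrow> \<bar>h W\<bar> \<le> c * (p\<^sup>2) ^ card W"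
  shows "\<bar>(\<Sum>W\<in>Pow G. h W) - (\<Sum>k<K. \<Sum>W\<in>subsets_card G k. h W)\<bar> \<le> 2 * c * x ^ K"
proof -
  have le: "(\<Sum>w\<in>G. p\<^sup>2) \<le> x" using assms(2) by (simp add: x_def mult_right_mono)
  have "\<bar>\<Sum>W\<in>subsets_ge G K. h W\<bar> \<le> (\<Sum>W\<in>subsets_ge G K. c * (p\<^sup>2) ^ card W)"
    by (rule order_trans[OF sum_abs sum_mono]) (auto simp: subsets_ge_def intro: assms(4))
  also have "\<dots> = c * (\<Sum>W\<in>subsets_ge G K. \<Prod>w\<in>W. p\<^sup>2)"
    by (simp add: sum_distrib_left)
  also have "\<dots> \<le> c * (2 * (\<Sum>w\<in>G. p\<^sup>2) ^ K)"
    using le x_small assms by (intro mult_left_mono sum_prod_subsets_ge) auto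
  also have "\<dots> \<le> c * (2 * x ^ K)"
    using le assms(3) by (intro mult_left_mono power_mono) (auto simp: sum_nonneg)
  finally show ?thesis using sum_Pow_split[OF assms(1), of h K] by simp
qed

text \<open>There are at most n^k sets, each of weight p^(2k). A uniform error \<open>b\<close> in
  the \<open>R\<close> factor therefore costs only b x^k, which is why larger configurations may be
  known less precisely.\<close>

lemma sum_subsets_card_approx:
  assumes "finite G" "card G \<le> n" "0 \<le> b"
    "\<And>W. W \<subseteq> G \<Longrightarrow> card W = k \<Longrightarrow> \<bar>h W - a * (p\<^sup>2) ^ k\<bar> \<le> b * (p\<^sup>2) ^ k"
  shows "\<bar>(\<Sum>W\<in>subsets_card G k. h W) - a * (real (card G choose k) * (p\<^sup>2) ^ k)\<bar> \<le> b * x ^ k"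
proof -
  have "(\<Sum>W\<in>subsets_card G k. h W) - a * (real (card G choose k) * (p\<^sup>2) ^ k) =
    (\<Sum>W\<in>subsets_card G k. h W - a * (p\<^sup>2) ^ k)"
    using assms(1) by (simp add: sum_subtractf card_subsets_card mult_ac)
  also have "\<bar>\<dots>\<bar> \<le> (\<Sum>W\<in>subsets_card G k. b * (p\<^sup>2) ^ k)"
    by (rule order_trans[OF sum_abs sum_mono]) (rule assms(4), auto simp: subsets_card_def)
  also have "\<dots> = b * (real (card G choose k) * (p\<^sup>2) ^ k)"
    using assms(1) by (simp add: card_subsets_card mult_ac)
  also have "\<dots> \<le> b * (real n ^ k * (p\<^sup>2) ^ k)"
  proof -
    have "card G choose k \<le> n ^ k"
    proof (cases "k \<le> card G")
      case True
      then have "card G choose k \<le> card G ^ k" by (rule binomial_le_pow)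
      also have "\<dots> \<le> n ^ k" using assms(2) by (rule power_mono) simp
      finally show ?thesis .
    qed (simp add: binomial_eq_0)
    then have "real (card G choose k) \<le> real n ^ k" by (metis of_nat_le_iff of_nat_power)
    then show ?thesis using assms(3) by (intro mult_left_mono mult_right_mono) auto
  qed
  also have "\<dots> = b * x ^ k" by (simp add: x_def power_mult_distrib)
  finally show ?thesis .
qed

lemma card_Union_edges_le:
  assumes "F \<subseteq> E" "card F \<le> 9"
  shows "card (\<Union>F) \<le> 18" "finite (\<Union>F)"
proof -
  have "card (\<Union>F) \<le> sum card F" by (rule card_Union_le_sum_card)
  also have "\<dots> = (\<Sum>e\<in>F. 2)" using assms(1) by (intro sum.cong) (auto simp: all_edges_def)
  finally show "card (\<Union>F) \<le> 18" using assms(2) by simp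
  have "\<Union>F \<subseteq> V" using assms(1) by (auto simp: all_edges_def)
  then show "finite (\<Union>F)" by (rule finite_subset) simp
qed

text \<open>A set \<open>W\<close> of at least two vertices, one of which lies on an edge of \<open>F\<close>, contributes only to
  the second-order term.\<close>

lemma sum_Pow_generic:
  assumes uv: "u \<noteq> v" "u < n" "v < n"
    and F: "F \<subseteq> E" "card F \<le> 9" "triangle_free (insert {u, v} F)"
    and c: "0 \<le> c" "\<And>W. W \<subseteq> V - {u, v} \<Longrightarrow> \<bar>h W\<bar> \<le> c * (\<Prod>w\<in>W. q F u v w)"
  shows "\<bar>(\<Sum>W\<in>Pow (V - {u, v}). h W) - (\<Sum>k<K. \<Sum>W\<in>subsets_card (V - {u, v} - \<Union>F) k. h W)
    - (\<Sum>w\<in>(V - {u, v}) \<inter> \<Union>F. h {w})\<bar> \<le> c * (2 * x ^ K + 36 * p * (x + 18 * p))"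
proof -
  let ?U = "V - {u, v}"
  let ?N = "?U \<inter> \<Union>F" and ?G = "?U - \<Union>F"
  let ?T = "{W \<in> subsets_ge ?U (Suc 1). W \<inter> ?N \<noteq> {}}"
  let ?q = "q F u v"
  have fin: "finite ?U" "finite ?G" "finite ?N" by auto
  have cG: "card ?G \<le> n" using card_mono[of V ?G] by auto
  have cN: "card ?N \<le> 18"
    using card_mono[of "\<Union>F" ?N] card_Union_edges_le[OF F(1,2)] by auto
  have qG: "?q w = p\<^sup>2" if "w \<in> ?G" for w using that uv by (intro q_generic) auto
  have qN: "(\<Sum>w\<in>?N. ?q w) \<le> 18 * p"
  proof -
    have "(\<Sum>w\<in>?N. ?q w) \<le> (\<Sum>w\<in>?N. p)" using uv by (intro sum_mono q_le F(3)) auto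
    also have "\<dots> \<le> 18 * p" using cN p_nonneg by (simp add: mult_right_mono)
    finally show ?thesis .
  qed
  have qU: "(\<Sum>w\<in>?U. ?q w) \<le> x + 18 * p"
  proof -
    have "?U = ?G \<union> ?N" by auto
    then have "(\<Sum>w\<in>?U. ?q w) = (\<Sum>w\<in>?G. ?q w) + (\<Sum>w\<in>?N. ?q w)"
      using sum.union_disjoint[of ?G ?N ?q] fin by auto
    moreover have "(\<Sum>w\<in>?G. ?q w) \<le> x"
      using cG by (simp add: qG x_def mult_right_mono)
    ultimately show ?thesis using qN by simp
  qed
  \<comment> \<open>Either \<open>W\<close> avoids \<open>F\<close>, or it is a single vertex on
    \<open>F\<close>, or it has a vertex on \<open>F\<close> and at least one more. The third group
    is estimated wholesale: a factor \<open>18 * p\<close> for its vertex on \<open>F\<close> and a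
    factor of order x + p for another one.\<close>
  have Pow: "Pow ?U = Pow ?G \<union> ((\<lambda>w. {w}) ` ?N \<union> ?T)" (is "_ = ?B")
  proof
    show "?B \<subseteq> Pow ?U" by (auto simp: subsets_ge_def)
    show "Pow ?U \<subseteq> ?B"
    proof
      fix W assume W: "W \<in> Pow ?U"
      show "W \<in> ?B"
      proof (cases "W \<inter> ?N = {}")
        case True
        then show ?thesis using W by blast
      next
        case False
        then obtain w where w: "w \<in> W" "w \<in> ?N" by blast
        have fW: "finite W" using W fin finite_subset by blast
        show ?thesis
        proof (cases "W = {w}")
          case True
          then show ?thesis using w by blast
        next
          case False
          have "card {w} < card W" using fW w False by (intro psubset_card_mono) auto
          then have "W \<in> ?T" using W w by (auto simp: subsets_ge_def)
          then show ?thesis by blast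
        qed
      qed
    qed
  qed
  have "(\<Sum>W\<in>Pow ?U. h W) = (\<Sum>W\<in>Pow ?G. h W) + (\<Sum>W\<in>(\<lambda>w. {w}) ` ?N \<union> ?T. h W)"
    unfolding Pow using fin by (intro sum.union_disjoint) (auto simp: subsets_ge_def)
  also have "(\<Sum>W\<in>(\<lambda>w. {w}) ` ?N \<union> ?T. h W) = (\<Sum>w\<in>?N. h {w}) + (\<Sum>W\<in>?T. h W)"
    using fin by (subst sum.union_disjoint) (auto simp: subsets_ge_def sum.reindex inj_on_def)
  finally have split: "(\<Sum>W\<in>Pow ?U. h W) = (\<Sum>W\<in>Pow ?G. h W) + ((\<Sum>w\<in>?N. h {w}) + (\<Sum>W\<in>?T. h W))" .
  have T: "\<bar>\<Sum>W\<in>?T. h W\<bar> \<le> c * (36 * p * (x + 18 * p))"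
  proof -
    have "\<bar>\<Sum>W\<in>?T. h W\<bar> \<le> (\<Sum>W\<in>?T. c * (\<Prod>w\<in>W. ?q w))"
      by (rule order_trans[OF sum_abs sum_mono]) (auto simp: subsets_ge_def intro: c(2))
    also have "\<dots> = c * (\<Sum>W\<in>?T. \<Prod>w\<in>W. ?q w)" by (simp add: sum_distrib_left)
    also have "\<dots> \<le> c * ((\<Sum>w\<in>?N. ?q w) * (\<Sum>W\<in>subsets_ge ?U 1. \<Prod>w\<in>W. ?q w))"
      by (intro mult_left_mono sum_prod_subsets_hit c(1) q_nonneg fin) auto
    also have "\<dots> \<le> c * ((18 * p) * (2 * (x + 18 * p)))"
    proof (intro mult_left_mono mult_mono c(1) qN)
      have "(\<Sum>W\<in>subsets_ge ?U 1. \<Prod>w\<in>W. ?q w) \<le> 2 * (\<Sum>w\<in>?U. ?q w) ^ 1"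
        using qU x_small p_small by (intro sum_prod_subsets_ge fin q_nonneg) auto
      then show "(\<Sum>W\<in>subsets_ge ?U 1. \<Prod>w\<in>W. ?q w) \<le> 2 * (x + 18 * p)" using qU by simp
    qed (auto intro!: sum_nonneg prod_nonneg q_nonneg p_nonneg mult_nonneg_nonneg)
    finally show ?thesis by (simp add: algebra_simps)
  qed
  have G: "\<bar>(\<Sum>W\<in>Pow ?G. h W) - (\<Sum>k<K. \<Sum>W\<in>subsets_card ?G k. h W)\<bar> \<le> 2 * c * x ^ K"
  proof (rule sum_Pow_truncate[OF fin(2) cG c(1)])
    fix W assume W: "W \<subseteq> ?G"
    then have "(\<Prod>w\<in>W. ?q w) = (\<Prod>w\<in>W. p\<^sup>2)" by (intro prod.cong qG) auto
    then show "\<bar>h W\<bar> \<le> c * (p\<^sup>2) ^ card W" using c(2)[of W] W by auto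
  qed
  show ?thesis using split T G by (simp add: algebra_simps)
qed

text \<open>At most 20 vertices are excluded: 18 endpoints of the edges of \<open>F\<close>, and
  \<open>u\<close> and \<open>v\<close>.\<close>

lemma card_generic:
  assumes "u < n" "v < n" "u \<noteq> v" "F \<subseteq> E" "card F \<le> 9"
  shows "\<bar>real (card (V - {u, v} - \<Union>F)) * p\<^sup>2 - x\<bar> \<le> 20 * p\<^sup>2"
proof -
  let ?G = "V - {u, v} - \<Union>F"
  have "card ?G \<le> n" using card_mono[of V ?G] by auto
  moreover have "n \<le> card ?G + 20"
  proof -
    have "n = card V" by simp
    also have "\<dots> \<le> card (?G \<union> ({u, v} \<union> \<Union>F))"
      using card_Union_edges_le[OF assms(4,5)] by (intro card_mono) auto
    also have "\<dots> \<le> card ?G + (card {u, v} + card (\<Union>F))"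
      by (intro order_trans[OF card_Un_le] add_mono card_Un_le order_refl)
    also have "\<dots> \<le> card ?G + 20" using card_Union_edges_le[OF assms(4,5)] assms(3) by simp
    finally show ?thesis .
  qed
  ultimately have "\<bar>real (card ?G) - real n\<bar> \<le> 20" by linarith
  then have "\<bar>real (card ?G) - real n\<bar> * p\<^sup>2 \<le> 20 * p\<^sup>2" by (intro mult_right_mono) auto
  moreover have "\<bar>real (card ?G) * p\<^sup>2 - x\<bar> = \<bar>real (card ?G) - real n\<bar> * p\<^sup>2"
    by (simp add: x_def abs_mult flip: left_diff_distrib)
  ultimately show ?thesis by simp
qed

section \<open>Expansion of \<open>R\<close> to orders zero and one\<close>

lemma abs_R_term:
  "\<bar>(-1) ^ k * ((\<Prod>w\<in>W. q F u v w) * R F')\<bar> \<le> (\<Prod>w\<in>W. q F u v w)"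
proof -
  have "0 \<le> (\<Prod>w\<in>W. q F u v w)" by (intro prod_nonneg q_nonneg)
  then show ?thesis using R_nonneg[of F'] R_le_1[of F'] by (simp add: abs_mult power_abs mult_left_le)
qed

lemma abs_sum_nongeneric_le:
  fixes g :: "nat \<Rightarrow> real"
  assumes uv: "u \<noteq> v" "u < n" "v < n"
    and F: "F \<subseteq> E" "card F \<le> 9"
    and b: "0 \<le> b" "\<And>w. w \<in> (V - {u, v}) \<inter> \<Union>F \<Longrightarrow> \<bar>g w\<bar> \<le> b"
  shows "\<bar>\<Sum>w\<in>(V - {u, v}) \<inter> \<Union>F. g w\<bar> \<le> 18 * b"
proof -
  let ?N = "(V - {u, v}) \<inter> \<Union>F"
  have cN: "card ?N \<le> 18"
    using card_mono[of "\<Union>F" ?N] card_Union_edges_le[OF F] by auto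
  have "\<bar>\<Sum>w\<in>?N. g w\<bar> \<le> (\<Sum>w\<in>?N. \<bar>g w\<bar>)" by (rule sum_abs)
  also have "\<dots> \<le> (\<Sum>w\<in>?N. b)" by (rule sum_mono) (rule b(2))
  also have "\<dots> \<le> 18 * b" using cN b(1) by (simp add: mult_right_mono)
  finally show ?thesis .
qed

text \<open>Truncation after the empty set, whose term is \<open>R F\<close>. At most 18 single
  vertices on \<open>F\<close> cost at most p each, and the remaining sets cost a multiple of x +
  p.\<close>

lemma R_insert_close:
  assumes uv: "u \<noteq> v" "u < n" "v < n"
    and F: "F \<subseteq> E" "card F \<le> 9" "triangle_free (insert {u, v} F)"
  shows "\<bar>R (insert {u, v} F) - R F\<bar> \<le> 25 * (x + p)"
proof -
  define h where "h W = (-1) ^ card W * ((\<Prod>w\<in>W. q F u v w) * R (F \<union> cherries u v W))" for W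
  have "\<bar>h {w}\<bar> \<le> p" if "w \<in> (V - {u, v}) \<inter> \<Union>F" for w
    using abs_R_term[of 1 F u v "{w}" "F \<union> cherries u v {w}"] q_le[OF F(3) uv(1), of w] that
    by (auto simp: h_def)
  then have N: "\<bar>\<Sum>w\<in>(V - {u, v}) \<inter> \<Union>F. h {w}\<bar> \<le> 18 * p"
    by (intro abs_sum_nongeneric_le uv F p_nonneg)
  have "\<bar>R (insert {u, v} F) - (\<Sum>k<1. \<Sum>W\<in>subsets_card (V - {u, v} - \<Union>F) k. h W)
      - (\<Sum>w\<in>(V - {u, v}) \<inter> \<Union>F. h {w})\<bar> \<le> 1 * (2 * x ^ 1 + 36 * p * (x + 18 * p))"
    unfolding R_insert_edge[OF uv F(1)] h_def[symmetric]
    by (rule sum_Pow_generic[OF uv F]) (simp_all add: h_def abs_R_term)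
  also have "(\<Sum>k<1. \<Sum>W\<in>subsets_card (V - {u, v} - \<Union>F) k. h W) = R F"
    by (simp add: subsets_card_0 h_def)
  finally have "\<bar>R (insert {u, v} F) - R F\<bar> \<le> 18 * p + (2 * x + 36 * p * (x + 18 * p))"
    using N by simp
  \<comment> \<open>Both 1/100 bounds together give \<open>x + 18 * p \<le> 19 / 100\<close>, so
    this second-order term is absorbed into the multiple of p.\<close>
  also have "36 * p * (x + 18 * p) \<le> 36 * p * (19 / 100)"
    using p_nonneg p_small x_small by (intro mult_left_mono) auto
  finally show ?thesis using p_nonneg x_nonneg by (simp add: algebra_simps)
qed

text \<open>Edges are inserted one by one, starting from \<open>R {} = 1\<close>; subsets of a
  triangle-free set stay triangle-free.\<close>

lemma R_close_1:
  assumes "F \<subseteq> E" "card F \<le> 10" "triangle_free F"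
  shows "\<bar>R F - 1\<bar> \<le> 250 * (x + p)"
proof -
  have "finite F" using assms(1) by (rule finite_subset) simp
  then have "\<bar>R F - 1\<bar> \<le> 25 * real (card F) * (x + p)"
    using assms
  proof (induction F rule: finite_induct)
    case (insert f F)
    obtain u v where f: "f = {u, v}" "u \<noteq> v" "u < n" "v < n"
      using insert.prems(1) by (auto simp: all_edges_def card_2_iff)
    have "triangle_free F" using insert.prems(3) by (rule triangle_free_subset) auto
    then have IH: "\<bar>R F - 1\<bar> \<le> 25 * real (card F) * (x + p)" using insert by auto
    have "\<bar>R (insert f F) - R F\<bar> \<le> 25 * (x + p)"
      using insert f unfolding f(1) by (intro R_insert_close) auto
    then show ?case using IH insert.hyps by (simp add: algebra_simps)
  qed simp
  also have "\<dots> \<le> 25 * 10 * (x + p)"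
    using assms(2) x_nonneg p_nonneg by (intro mult_right_mono mult_left_mono) auto
  finally show ?thesis by simp
qed

lemma union_cherries_props:
  assumes "u \<noteq> v" "u < n" "v < n" "F \<subseteq> E" "{u, v} \<notin> F" "triangle_free F"
    "W \<subseteq> V - {u, v} - \<Union>F"
  shows "F \<union> cherries u v W \<subseteq> E" "card (F \<union> cherries u v W) = card F + 2 * card W"
    "triangle_free (F \<union> cherries u v W)"
proof -
  have fW: "finite W" using assms(7) by (rule finite_subset) simp
  have fF: "finite F" using assms(4) by (rule finite_subset) simp
  show "F \<union> cherries u v W \<subseteq> E" using assms cherries_subset[of u V v W] by auto
  have "F \<inter> cherries u v W = {}" using assms(7) by (auto simp: cherries_def)
  then show "card (F \<union> cherries u v W) = card F + 2 * card W"
    using assms card_cherries[of W u v] fW fF by (subst card_Un_disjoint) auto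
  show "triangle_free (F \<union> cherries u v W)"
    using assms by (intro triangle_free_cherries) auto
qed

text \<open>Now single generic vertices are kept as well. By the zeroth-order estimate their
  \<open>R\<close> is close to 1, so together they contribute -x.\<close>

lemma R_insert_first_order:
  assumes uv: "u \<noteq> v" "u < n" "v < n" and new: "{u, v} \<notin> F"
    and F: "F \<subseteq> E" "card F \<le> 8" "triangle_free (insert {u, v} F)"
  shows "\<bar>R (insert {u, v} F) - R F + x\<bar> \<le> 252 * (p + x\<^sup>2)"
proof -
  let ?G = "V - {u, v} - \<Union>F"
  have F9: "card F \<le> 9" using F by simp
  have TF: "triangle_free F" using F(3) by (rule triangle_free_subset) auto
  define h where "h W = (-1) ^ card W * ((\<Prod>w\<in>W. q F u v w) * R (F \<union> cherries u v W))" for W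
  have "\<bar>h {w}\<bar> \<le> p" if "w \<in> (V - {u, v}) \<inter> \<Union>F" for w
    using abs_R_term[of 1 F u v "{w}" "F \<union> cherries u v {w}"] q_le[OF F(3) uv(1), of w] that
    by (auto simp: h_def)
  then have N: "\<bar>\<Sum>w\<in>(V - {u, v}) \<inter> \<Union>F. h {w}\<bar> \<le> 18 * p"
    by (intro abs_sum_nongeneric_le uv F F9 p_nonneg)
  have k1: "\<bar>(\<Sum>W\<in>subsets_card ?G 1. h W) - (-1) * (real (card ?G choose 1) * (p\<^sup>2) ^ 1)\<bar>
      \<le> 250 * (x + p) * x ^ 1"
  proof (rule sum_subsets_card_approx)
    show "card ?G \<le> n" using card_mono[of V ?G] by auto
    show "0 \<le> 250 * (x + p)" using x_nonneg p_nonneg by simp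
    fix W assume W: "W \<subseteq> ?G" "card W = 1"
    then obtain w where w: "W = {w}" by (auto simp: card_1_singleton_iff)
    \<comment> \<open>\<open>F\<close> and the new cherry have at most 8 + 2 = 10 edges, the limit
      of \<open>R_close_1\<close>.\<close>
    have "\<bar>R (F \<union> cherries u v W) - 1\<bar> \<le> 250 * (x + p)"
      using union_cherries_props[OF uv F(1) new TF W(1)] F(2) W(2) by (intro R_close_1) auto
    then have le: "\<bar>1 - R (F \<union> cherries u v W)\<bar> \<le> 250 * (x + p)" by (simp add: abs_minus_commute)
    have "h W = - (p\<^sup>2 * R (F \<union> cherries u v W))"
      using q_generic[of u v w F] uv W w by (auto simp: h_def)
    then have "h W - (-1) * (p\<^sup>2) ^ 1 = (1 - R (F \<union> cherries u v W)) * (p\<^sup>2) ^ 1"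
      by (simp add: algebra_simps)
    then have "\<bar>h W - (-1) * (p\<^sup>2) ^ 1\<bar> = \<bar>1 - R (F \<union> cherries u v W)\<bar> * (p\<^sup>2) ^ 1"
      by (simp only: abs_mult) simp
    also have "\<dots> \<le> 250 * (x + p) * (p\<^sup>2) ^ 1" using le by (intro mult_right_mono) auto
    finally show "\<bar>h W - (-1) * (p\<^sup>2) ^ 1\<bar> \<le> 250 * (x + p) * (p\<^sup>2) ^ 1" .
  qed simp
  have "\<bar>R (insert {u, v} F) - (\<Sum>k<2. \<Sum>W\<in>subsets_card ?G k. h W)
      - (\<Sum>w\<in>(V - {u, v}) \<inter> \<Union>F. h {w})\<bar> \<le> 1 * (2 * x ^ 2 + 36 * p * (x + 18 * p))"
    unfolding R_insert_edge[OF uv F(1)] h_def[symmetric]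
    by (rule sum_Pow_generic[OF uv F(1) F9 F(3)]) (simp_all add: h_def abs_R_term)
  also have "(\<Sum>k<2. \<Sum>W\<in>subsets_card ?G k. h W) = R F + (\<Sum>W\<in>subsets_card ?G 1. h W)"
    by (simp add: subsets_card_0 h_def numeral_2_eq_2)
  finally have "\<bar>R (insert {u, v} F) - R F + x\<bar> \<le>
      18 * p + 20 * p\<^sup>2 + 250 * (x + p) * x + (2 * x\<^sup>2 + 36 * p * (x + 18 * p))"
    using N k1 card_generic[OF uv(2,3,1) F(1) F9] by (simp add: algebra_simps)
  also have "36 * p * (x + 18 * p) \<le> 36 * p * (19 / 100)"
    using p_nonneg p_small x_small by (intro mult_left_mono) auto
  also have "20 * p\<^sup>2 \<le> p"
    using mult_left_mono[OF p_small p_nonneg] p_nonneg by (simp add: power2_eq_square)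
  also have "250 * (x + p) * x \<le> 250 * x\<^sup>2 + 3 * p"
    using mult_left_mono[OF x_small p_nonneg] p_nonneg by (simp add: power2_eq_square algebra_simps)
  finally show ?thesis using p_nonneg x_nonneg by (simp add: algebra_simps)
qed

lemma R_first_order:
  assumes "F \<subseteq> E" "card F \<le> 9" "triangle_free F"
  shows "\<bar>R F - (1 - real (card F) * x)\<bar> \<le> 2268 * (p + x\<^sup>2)"
proof -
  have "finite F" using assms(1) by (rule finite_subset) simp
  then have "\<bar>R F - (1 - real (card F) * x)\<bar> \<le> 252 * real (card F) * (p + x\<^sup>2)"
    using assms
  proof (induction F rule: finite_induct)
    case (insert f F)
    obtain u v where f: "f = {u, v}" "u \<noteq> v" "u < n" "v < n"
      using insert.prems(1) by (auto simp: all_edges_def card_2_iff)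
    have "triangle_free F" using insert.prems(3) by (rule triangle_free_subset) auto
    then have IH: "\<bar>R F - (1 - real (card F) * x)\<bar> \<le> 252 * real (card F) * (p + x\<^sup>2)" using insert by auto
    have "\<bar>R (insert f F) - R F + x\<bar> \<le> 252 * (p + x\<^sup>2)"
      using insert f unfolding f(1) by (intro R_insert_first_order) auto
    then show ?case using IH insert.hyps by (simp add: algebra_simps)
  qed simp
  also have "\<dots> \<le> 252 * 9 * (p + x\<^sup>2)"
    using assms(2) p_nonneg by (intro mult_right_mono mult_left_mono) auto
  finally show ?thesis by simp
qed

text \<open>To first order \<open>R\<close> depends only on the number of edges, and 1 - mx times 1
  - kx is 1 - (m + k)x up to O(x^2). So \<open>R\<close> is multiplicative to this order.\<close>

lemma R_union_cherries:
  assumes uv: "u \<noteq> v" "u < n" "v < n"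
    and F: "F \<subseteq> E" "{u, v} \<notin> F" "triangle_free F"
    and W: "W \<subseteq> V - {u, v} - \<Union>F" "card F + 2 * card W \<le> 9"
  shows "\<bar>R (F \<union> cherries u v W) - R F * R (cherries u v W)\<bar> \<le> 7000 * (p + x\<^sup>2)"
proof -
  let ?C = "cherries u v W"
  let ?m = "real (card F)" and ?k = "2 * real (card W)" and ?e = "2268 * (p + x\<^sup>2)"
  note F_C = union_cherries_props[OF uv F W(1)]
  have C: "?C \<subseteq> E" "card ?C = 2 * card W" "triangle_free ?C"
    using union_cherries_props[OF uv, of "{}" W] W by auto
  have 1: "\<bar>R (F \<union> ?C) - (1 - (?m + ?k) * x)\<bar> \<le> ?e"
    using R_first_order[of "F \<union> ?C"] F_C W(2) by auto
  have 2: "\<bar>R F - (1 - ?m * x)\<bar> \<le> ?e" using R_first_order[of F] F W(2) by auto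
  have 3: "\<bar>R ?C - (1 - ?k * x)\<bar> \<le> ?e" using R_first_order[of ?C] C W(2) by auto
  have mk: "?m + ?k \<le> 9" using W(2) by linarith
  have m9: "?m \<le> 9" "?k \<le> 9" using mk by auto
  have "?m * x \<le> 9 * (1 / 100)" using m9 x_small x_nonneg by (intro mult_mono) auto
  then have a: "0 \<le> 1 - ?m * x" "1 - ?m * x \<le> 1" using x_nonneg by auto
  have "R F * R ?C - (1 - ?m * x) * (1 - ?k * x) =
      (R F - (1 - ?m * x)) * R ?C + (1 - ?m * x) * (R ?C - (1 - ?k * x))"
    by (simp add: algebra_simps)
  also have "\<bar>\<dots>\<bar> \<le> \<bar>R F - (1 - ?m * x)\<bar> * \<bar>R ?C\<bar> + \<bar>1 - ?m * x\<bar> * \<bar>R ?C - (1 - ?k * x)\<bar>"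
    unfolding abs_mult[symmetric] by (rule abs_triangle_ineq)
  also have "\<dots> \<le> ?e * 1 + 1 * ?e"
  proof (intro add_mono mult_mono 2 3)
    show "0 \<le> ?e" using p_nonneg by simp
    show "\<bar>R ?C\<bar> \<le> 1" using R_nonneg[of ?C] R_le_1[of ?C] by simp
    show "\<bar>1 - ?m * x\<bar> \<le> 1" using a by simp
  qed auto
  finally have 4: "\<bar>R F * R ?C - (1 - ?m * x) * (1 - ?k * x)\<bar> \<le> 2 * ?e" by simp
  have 5: "(1 - ?m * x) * (1 - ?k * x) - (1 - (?m + ?k) * x) = ?m * ?k * x\<^sup>2"
    by (simp add: algebra_simps power2_eq_square)
  have "?m * ?k \<le> 9 * 9" using m9 by (intro mult_mono) auto
  then have "?m * ?k * x\<^sup>2 \<le> 81 * x\<^sup>2" by (intro mult_right_mono) auto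
  moreover have "0 \<le> ?m * ?k * x\<^sup>2" by simp
  ultimately have "\<bar>R (F \<union> ?C) - R F * R ?C\<bar> \<le> 3 * ?e + 81 * x\<^sup>2"
    using 1 4 5 by linarith
  then show ?thesis using p_nonneg by (simp add: algebra_simps)
qed

section \<open>Comparison of \<open>R\<close> with products, to second order\<close>

lemma R_single_edge:
  assumes uv: "u \<noteq> v" "u < n" "v < n"
  shows "R {{u, v}} = (\<Sum>W\<in>Pow (V - {u, v}). (-1) ^ card W * ((p\<^sup>2) ^ card W * R (cherries u v W)))"
proof -
  have "(\<Prod>w\<in>W. q {} u v w) = (p\<^sup>2) ^ card W" if "W \<in> Pow (V - {u, v})" for W
  proof -
    have "(\<Prod>w\<in>W. q {} u v w) = (\<Prod>w\<in>W. p\<^sup>2)"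
      using that uv by (intro prod.cong q_generic) auto
    then show ?thesis by simp
  qed
  then show ?thesis using R_insert_edge[OF uv, of "{}"] by simp
qed

text \<open>The summand for \<open>W\<close> in the expansion of \<open>R (insert {u, v} F)\<close>
  minus \<open>R F\<close> times the corresponding summand for \<open>R {{u, v}}\<close>. For
  generic \<open>W\<close> both have the same weight, so only the defect of multiplicativity of
  \<open>R\<close> remains.\<close>

definition diff_term :: "nat set set \<Rightarrow> nat \<Rightarrow> nat \<Rightarrow> nat set \<Rightarrow> real" where
  "diff_term F u v W = (-1) ^ card W * ((\<Prod>w\<in>W. q F u v w) * R (F \<union> cherries u v W)
    - (p\<^sup>2) ^ card W * (R F * R (cherries u v W)))"

lemma R_insert_diff_term:
  assumes uv: "u \<noteq> v" "u < n" "v < n" and "F \<subseteq> E"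
  shows "R (insert {u, v} F) - R F * R {{u, v}} = (\<Sum>W\<in>Pow (V - {u, v}). diff_term F u v W)"
  unfolding R_single_edge[OF uv] R_insert_edge[OF assms] diff_term_def sum_distrib_left sum_subtractf[symmetric]
  by (rule sum.cong) (auto simp: algebra_simps)

lemma abs_diff_term_le: "\<bar>diff_term F u v W\<bar> \<le> 2 * (\<Prod>w\<in>W. q F u v w)"
proof -
  let ?Q = "\<Prod>w\<in>W. q F u v w"
  have "(p\<^sup>2) ^ card W = (\<Prod>w\<in>W. p\<^sup>2)" by simp
  also have "\<dots> \<le> ?Q" by (intro prod_mono) (auto intro: p2_le_q)
  finally have le: "(p\<^sup>2) ^ card W \<le> ?Q" .
  have "?Q * R (F \<union> cherries u v W) \<le> ?Q * 1" "0 \<le> ?Q * R (F \<union> cherries u v W)"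
    by (intro mult_left_mono mult_nonneg_nonneg R_le_1 R_nonneg prod_nonneg q_nonneg; simp)+
  moreover have "(p\<^sup>2) ^ card W * (R F * R (cherries u v W)) \<le> (p\<^sup>2) ^ card W * (1 * 1)"
    by (intro mult_left_mono mult_mono R_le_1 R_nonneg) auto
  moreover have "0 \<le> (p\<^sup>2) ^ card W * (R F * R (cherries u v W))"
    by (intro mult_nonneg_nonneg R_nonneg) auto
  ultimately show ?thesis using le by (simp add: diff_term_def abs_mult power_abs)
qed

lemma prod_q_generic:
  assumes "u \<noteq> v" "W \<subseteq> V - {u, v} - \<Union>F"
  shows "(\<Prod>w\<in>W. q F u v w) = (p\<^sup>2) ^ card W"
proof -
  have "(\<Prod>w\<in>W. q F u v w) = (\<Prod>w\<in>W. p\<^sup>2)"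
    using assms by (intro prod.cong q_generic) auto
  then show ?thesis by simp
qed

lemma diff_term_generic:
  assumes "u \<noteq> v" "W \<subseteq> V - {u, v} - \<Union>F"
  shows "diff_term F u v W = (-1) ^ card W * (R (F \<union> cherries u v W) - R F * R (cherries u v W)) * (p\<^sup>2) ^ card W"
  unfolding diff_term_def prod_q_generic[OF assms] by (simp add: algebra_simps)

text \<open>\<open>R_union_cherries\<close> gains a factor p + x^2 over the trivial bound
  x^k.\<close>

lemma sum_diff_term_generic:
  assumes uv: "u \<noteq> v" "u < n" "v < n"
    and F: "F \<subseteq> E" "{u, v} \<notin> F" "triangle_free F" "card F + 2 * k \<le> 9"
  shows "\<bar>\<Sum>W\<in>subsets_card (V - {u, v} - \<Union>F) k. diff_term F u v W\<bar> \<le> 7000 * (p + x\<^sup>2) * x ^ k"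
proof -
  let ?G = "V - {u, v} - \<Union>F"
  have "\<bar>(\<Sum>W\<in>subsets_card ?G k. diff_term F u v W) - 0 * (real (card ?G choose k) * (p\<^sup>2) ^ k)\<bar>
    \<le> 7000 * (p + x\<^sup>2) * x ^ k"
  proof (rule sum_subsets_card_approx)
    show "card ?G \<le> n" using card_mono[of V ?G] by auto
    show "0 \<le> 7000 * (p + x\<^sup>2)" using p_nonneg by simp
    fix W assume W: "W \<subseteq> ?G" "card W = k"
    have "\<bar>diff_term F u v W\<bar> = \<bar>R (F \<union> cherries u v W) - R F * R (cherries u v W)\<bar> * (p\<^sup>2) ^ k"
      unfolding diff_term_generic[OF uv(1) W(1)] W(2) by (simp add: abs_mult power_abs)
    also have "\<dots> \<le> 7000 * (p + x\<^sup>2) * (p\<^sup>2) ^ k"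
      using R_union_cherries[OF uv F(1-3) W(1)] F(4) W(2) by (intro mult_right_mono) auto
    finally show "\<bar>diff_term F u v W - 0 * (p\<^sup>2) ^ k\<bar> \<le> 7000 * (p + x\<^sup>2) * (p\<^sup>2) ^ k" by simp
  qed simp
  then show ?thesis by simp
qed

lemma diff_term_empty [simp]: "diff_term F u v {} = 0"
  by (simp add: diff_term_def)

lemma diff_term_singleton:
  "diff_term F u v {w} = - (q F u v w * R (F \<union> cherries u v {w}) - p\<^sup>2 * (R F * R (cherries u v {w})))"
  by (simp add: diff_term_def)

lemma p2_mult_R_bounds: "0 \<le> p\<^sup>2 * (R F * R F')" "p\<^sup>2 * (R F * R F') \<le> p\<^sup>2"
proof -
  show "0 \<le> p\<^sup>2 * (R F * R F')" by (intro mult_nonneg_nonneg R_nonneg) auto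
  have "p\<^sup>2 * (R F * R F') \<le> p\<^sup>2 * (1 * 1)"
    by (intro mult_left_mono mult_mono R_le_1 R_nonneg) auto
  then show "p\<^sup>2 * (R F * R F') \<le> p\<^sup>2" by simp
qed

text \<open>\<open>A\<close> collects the vertices that complete an edge of \<open>F\<close> adjacent to \<open>{u, v}\<close> to a triangle
  with \<open>{u, v}\<close> by a single further edge which itself creates no triangle with \<open>F\<close>.\<close>

lemma R_insert_second_order:
  assumes uv: "u \<noteq> v" "u < n" "v < n" and new: "{u, v} \<notin> F"
    and F: "F \<subseteq> E" "card F \<le> 3" "triangle_free (insert {u, v} F)"
    and A: "A \<subseteq> (V - {u, v}) \<inter> \<Union>F"
      "\<And>w. w \<in> A \<Longrightarrow> q F u v w = p \<and> triangle_free (F \<union> cherries u v {w})"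
      "\<And>w. w \<in> (V - {u, v}) \<inter> \<Union>F \<Longrightarrow> w \<notin> A \<Longrightarrow> q F u v w = p\<^sup>2 \<or> \<not> triangle_free (F \<union> cherries u v {w})"
  shows "\<bar>R (insert {u, v} F) - R F * R {{u, v}} + real (card A) * p\<bar> \<le> 12000 * (x * p + x ^ 3 + p\<^sup>2)"
proof -
  let ?G = "V - {u, v} - \<Union>F" and ?N = "(V - {u, v}) \<inter> \<Union>F"
  have F9: "card F \<le> 9" using F by simp
  have TF: "triangle_free F" using F(3) by (rule triangle_free_subset) auto
  have fF: "finite F" using F(1) by (rule finite_subset) simp
  have xp: "0 \<le> x * p" "0 \<le> p\<^sup>2" "0 \<le> p * (x + p)"
    using x_nonneg p_nonneg by auto
  \<comment> \<open>A vertex of \<open>A\<close> contributes -p up to O(p (x + p)), since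
    \<open>R\<close> is close to 1 there. Any other vertex on \<open>F\<close> contributes O(p^2):
    either both edges of its cherry are new, or \<open>R\<close> vanishes because of a triangle. The
    subtracted product is always at most p^2.\<close>
  have bound: "\<bar>diff_term F u v {w} + (if w \<in> A then p else 0)\<bar> \<le> 250 * (p * (x + p)) + 2 * p\<^sup>2" if w: "w \<in> ?N" for w
  proof (cases "w \<in> A")
    case True
    have w': "w \<in> V" "w \<noteq> u" "w \<noteq> v" using w by auto
    have "F \<union> cherries u v {w} \<subseteq> E"
      using F(1) uv w' by (auto simp: cherries_def)
    moreover have "card (F \<union> cherries u v {w}) \<le> 10"
      using card_Un_le[of F "cherries u v {w}"] card_cherries_le[of "{w}" u v] F(2) by simp
    ultimately have "\<bar>R (F \<union> cherries u v {w}) - 1\<bar> \<le> 250 * (x + p)"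
      using A(2)[OF True] by (intro R_close_1) auto
    then have "p * \<bar>R (F \<union> cherries u v {w}) - 1\<bar> \<le> p * (250 * (x + p))"
      using p_nonneg by (intro mult_left_mono)
    moreover have "p * \<bar>R (F \<union> cherries u v {w}) - 1\<bar> = \<bar>p * R (F \<union> cherries u v {w}) - p\<bar>"
      using p_nonneg by (simp add: abs_mult_pos' right_diff_distrib)
    ultimately have "\<bar>p * R (F \<union> cherries u v {w}) - p\<bar> \<le> 250 * (p * (x + p))"
      by (simp add: algebra_simps)
    then show ?thesis
      using A(2)[OF True] True p2_mult_R_bounds[of F "cherries u v {w}"] xp unfolding diff_term_singleton by auto
  next
    case False
    from A(3)[OF w False] have "\<bar>q F u v w * R (F \<union> cherries u v {w})\<bar> \<le> p\<^sup>2"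
    proof
      assume "q F u v w = p\<^sup>2"
      then show ?thesis using R_nonneg[of "F \<union> cherries u v {w}"] R_le_1[of "F \<union> cherries u v {w}"]
        by (simp add: abs_mult mult_left_le)
    qed (simp add: R_not_triangle_free)
    then show ?thesis
      using False p2_mult_R_bounds[of F "cherries u v {w}"] xp unfolding diff_term_singleton by auto
  qed
  have "(\<Sum>w\<in>?N. diff_term F u v {w}) + real (card A) * p = (\<Sum>w\<in>?N. diff_term F u v {w} + (if w \<in> A then p else 0))"
  proof -
    have "?N \<inter> A = A" using A(1) by auto
    then show ?thesis by (simp add: sum.distrib sum.If_cases)
  qed
  also have "\<bar>\<dots>\<bar> \<le> 18 * (250 * (p * (x + p)) + 2 * p\<^sup>2)"
    using xp by (intro abs_sum_nongeneric_le uv F F9 bound) auto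
  finally have N: "\<bar>(\<Sum>w\<in>?N. diff_term F u v {w}) + real (card A) * p\<bar> \<le> 4500 * (p * x) + 4536 * p\<^sup>2"
    by (simp add: algebra_simps power2_eq_square)
  \<comment> \<open>Truncation at three vertices leaves O(x^3). The empty set cancels exactly, and
    sizes 1 and 2 have the gain p + x^2.\<close>
  have "\<bar>R (insert {u, v} F) - R F * R {{u, v}} - (\<Sum>k<3. \<Sum>W\<in>subsets_card ?G k. diff_term F u v W)
      - (\<Sum>w\<in>?N. diff_term F u v {w})\<bar> \<le> 2 * (2 * x ^ 3 + 36 * p * (x + 18 * p))"
    unfolding R_insert_diff_term[OF uv F(1)]
    by (rule sum_Pow_generic[OF uv F(1) F9 F(3)]) (simp_all add: abs_diff_term_le)
  also have "(\<Sum>k<3. \<Sum>W\<in>subsets_card ?G k. diff_term F u v W) =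
      (\<Sum>W\<in>subsets_card ?G 1. diff_term F u v W) + (\<Sum>W\<in>subsets_card ?G 2. diff_term F u v W)"
    by (simp add: subsets_card_0 numeral_3_eq_3 numeral_2_eq_2)
  finally have "\<bar>R (insert {u, v} F) - R F * R {{u, v}} + real (card A) * p\<bar> \<le>
      2 * (2 * x ^ 3 + 36 * p * (x + 18 * p)) + (4500 * (p * x) + 4536 * p\<^sup>2)
      + 7000 * (p + x\<^sup>2) * x ^ 1 + 7000 * (p + x\<^sup>2) * x ^ 2"
    using N sum_diff_term_generic[OF uv F(1) new TF, of 1] sum_diff_term_generic[OF uv F(1) new TF, of 2] F(2)
    by linarith
  also have "7000 * (p + x\<^sup>2) * x ^ 2 \<le> 7000 * (p + x\<^sup>2) * x * (1 / 100)"
    using mult_left_mono[OF x_small, of "7000 * (p + x\<^sup>2) * x"] x_nonneg p_nonneg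
    by (simp add: power2_eq_square mult.assoc)
  finally have "\<bar>R (insert {u, v} F) - R F * R {{u, v}} + real (card A) * p\<bar>
      \<le> 7074 * x ^ 3 + 11642 * (x * p) + 5832 * p\<^sup>2"
    by (simp add: algebra_simps power2_eq_square power3_eq_cube)
  moreover have "0 \<le> x ^ 3" using x_nonneg by simp
  ultimately show ?thesis using xp by argo
qed

section \<open>Paths and the 4-cycle\<close>

lemma q_one:
  assumes "{u, w} \<in> F" "{v, w} \<notin> F"
  shows "q F u v w = p" "q F v u w = p"
proof -
  have "{{u, w}, {v, w}} - F = {{v, w}}" "{{v, w}, {u, w}} - F = {{v, w}}" using assms by auto
  then show "q F u v w = p" "q F v u w = p" by (auto simp: q_def)
qed

lemma q_two:
  assumes "{u, w} \<notin> F" "{v, w} \<notin> F" "u \<noteq> v"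
  shows "q F u v w = p\<^sup>2"
proof -
  have "{{u, w}, {v, w}} - F = {{u, w}, {v, w}}" using assms by auto
  moreover have "{u, w} \<noteq> {v, w}" using assms by (auto simp: doubleton_eq_iff)
  ultimately show ?thesis by (simp add: q_def power2_eq_square)
qed

text \<open>With \<open>{v, w}\<close> inserted, the end \<open>u\<close> of the old edge is one
  edge, \<open>{u, v}\<close>, away from a triangle; so \<open>A = {u}\<close> and the correction is
  -p.\<close>

lemma R_path3:
  assumes "distinct [u, v, w]" "u < n" "v < n" "w < n"
  shows "\<bar>R {{v, w}, {u, w}} - R {{u, w}} * R {{v, w}} + p\<bar> \<le> 12000 * (x * p + x ^ 3 + p\<^sup>2)"
proof -
  have "\<bar>R (insert {v, w} {{u, w}}) - R {{u, w}} * R {{v, w}} + real (card {u}) * p\<bar>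
    \<le> 12000 * (x * p + x ^ 3 + p\<^sup>2)"
  proof (rule R_insert_second_order)
    show "triangle_free (insert {v, w} {{u, w}})"
      by (rule triangle_free_bipartite[where A = "{w}"]) (use assms in \<open>auto simp: doubleton_eq_iff\<close>)
    fix z assume "z \<in> {u}"
    moreover have "q {{u, w}} v w u = p"
      using assms by (intro q_one(2)) (auto simp: doubleton_eq_iff)
    moreover have "triangle_free ({{u, w}} \<union> cherries v w {u})"
      by (rule triangle_free_bipartite[where A = "{u}"])
        (use assms in \<open>auto simp: cherries_def doubleton_eq_iff\<close>)
    ultimately show "q {{u, w}} v w z = p \<and> triangle_free ({{u, w}} \<union> cherries v w {z})" by simp
  qed (use assms in \<open>auto simp: doubleton_eq_iff\<close>)
  then show ?thesis by simp
qed

text \<open>Only \<open>z\<close> counts: its edge to \<open>v\<close> is present and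
  \<open>{w, z}\<close> is missing. The far end \<open>u\<close> would need two new edges.\<close>

lemma R_path4:
  assumes "distinct [u, v, w, z]" "u < n" "v < n" "w < n" "z < n"
  shows "\<bar>R {{v, w}, {u, z}, {v, z}} - R {{u, z}, {v, z}} * R {{v, w}} + p\<bar>
    \<le> 12000 * (x * p + x ^ 3 + p\<^sup>2)"
proof -
  let ?F = "{{u, z}, {v, z}}"
  have "\<bar>R (insert {v, w} ?F) - R ?F * R {{v, w}} + real (card {z}) * p\<bar>
    \<le> 12000 * (x * p + x ^ 3 + p\<^sup>2)"
  proof (rule R_insert_second_order)
    show "triangle_free (insert {v, w} ?F)"
      by (rule triangle_free_bipartite[where A = "{u, v}"]) (use assms in \<open>auto simp: doubleton_eq_iff\<close>)
    show "card ?F \<le> 3" by (simp add: card_insert_if)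
    fix z' assume "z' \<in> {z}"
    moreover have "q ?F v w z = p"
      using assms by (intro q_one(1)) (auto simp: doubleton_eq_iff)
    moreover have "triangle_free (?F \<union> cherries v w {z})"
      by (rule triangle_free_bipartite[where A = "{z}"])
        (use assms in \<open>auto simp: cherries_def doubleton_eq_iff\<close>)
    ultimately show "q ?F v w z' = p \<and> triangle_free (?F \<union> cherries v w {z'})" by simp
  next
    fix z' assume "z' \<in> (V - {v, w}) \<inter> \<Union>?F" "z' \<notin> {z}"
    then have "z' = u" by auto
    then show "q ?F v w z' = p\<^sup>2 \<or> \<not> triangle_free (?F \<union> cherries v w {z'})"
      using assms by (intro disjI1 q_two) (auto simp: doubleton_eq_iff)
  qed (use assms in \<open>auto simp: doubleton_eq_iff\<close>)
  then show ?thesis by simp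
qed

text \<open>Closing the cycle costs nothing: a cherry over \<open>{u, w}\<close> at \<open>v\<close>
  or \<open>z\<close> adds a chord of the 4-cycle, which already forms a triangle with two edges of
  the path. So \<open>A\<close> is empty.\<close>

lemma R_cycle4:
  assumes "distinct [u, v, w, z]" "u < n" "v < n" "w < n" "z < n"
  shows "\<bar>R {{u, w}, {v, w}, {u, z}, {v, z}} - R {{v, w}, {u, z}, {v, z}} * R {{u, w}}\<bar>
    \<le> 12000 * (x * p + x ^ 3 + p\<^sup>2)"
proof -
  let ?F = "{{v, w}, {u, z}, {v, z}}"
  have "\<bar>R (insert {u, w} ?F) - R ?F * R {{u, w}} + real (card ({} :: nat set)) * p\<bar>
    \<le> 12000 * (x * p + x ^ 3 + p\<^sup>2)"
  proof (rule R_insert_second_order)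
    show "triangle_free (insert {u, w} ?F)"
      by (rule triangle_free_bipartite[where A = "{u, v}"]) (use assms in \<open>auto simp: doubleton_eq_iff\<close>)
    show "card ?F \<le> 3" by (simp add: card_insert_if)
    fix z' assume z': "z' \<in> (V - {u, w}) \<inter> \<Union>?F"
    have "\<not> triangle_free (?F \<union> cherries u w {v})"
      using triangle_freeD[of "?F \<union> cherries u w {v}" u v z] assms by (auto simp: cherries_def)
    moreover have "\<not> triangle_free (?F \<union> cherries u w {z})"
      using triangle_freeD[of "?F \<union> cherries u w {z}" v w z] assms by (auto simp: cherries_def)
    moreover have "z' = v \<or> z' = z" using z' by auto
    ultimately show "q ?F u w z' = p\<^sup>2 \<or> \<not> triangle_free (?F \<union> cherries u w {z'})" by auto
  qed (use assms in \<open>auto simp: doubleton_eq_iff\<close>)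
  then show ?thesis by simp
qed

text \<open>The path enters the edge equation with a factor x only, so the accuracy x p + x^3 + p^2
  of \<open>R_path3\<close> does not suffice. The 4xp collects 2xp from \<open>W = {w}\<close>, xp
  from \<open>W = {w, z}\<close> and xp from \<open>W = {z}\<close> with \<open>z\<close>
  generic.\<close>

lemma R_path3_fine:
  assumes d: "distinct [u, v, w]" and lt: "u < n" "v < n" "w < n"
  shows "\<bar>R {{u, v}, {v, w}} - R {{v, w}} * R {{u, v}} + p - 4 * x * p\<bar>
    \<le> 30000 * (x\<^sup>2 * p + p\<^sup>2 + x ^ 4)"
proof -
  let ?F = "{{v, w}}" and ?G = "V - {u, v} - \<Union>{{v, w}}"
  let ?h = "diff_term ?F u v"
  let ?c = "real (card ?G) * p\<^sup>2"
  have uv: "u \<noteq> v" using d by auto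
  have FE: "?F \<subseteq> E" and new: "{u, v} \<notin> ?F" using d lt by (auto simp: doubleton_eq_iff)
  have TF: "triangle_free ?F"
    by (rule triangle_free_bipartite[where A = "{v}"]) (use d in \<open>auto simp: doubleton_eq_iff\<close>)
  have fG: "finite ?G" "card ?G \<le> n" "w \<notin> ?G" using card_mono[of V ?G] by auto
  \<comment> \<open>\<open>w\<close> is the only vertex on \<open>F\<close> besides \<open>u\<close>
    and \<open>v\<close>. So the sum splits exactly into sets avoiding \<open>w\<close> and sets
    containing \<open>w\<close>, and the latter can be expanded as well instead of merely
    estimated.\<close>
  have U: "V - {u, v} = insert w ?G" using d lt by auto
  have qw: "q ?F u v w = p" using d by (intro q_one(2)) (auto simp: doubleton_eq_iff)
  have Gprops: "z < n" "distinct [u, v, w, z]" if "z \<in> ?G" for z using that d by auto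
  have prod_ins: "(\<Prod>z\<in>insert w W. q ?F u v z) = p * (p\<^sup>2) ^ card W" if "W \<subseteq> ?G" for W
  proof -
    have "finite W" "w \<notin> W" using that by (auto intro: finite_subset[OF that fG(1)])
    then show ?thesis using prod_q_generic[OF uv that] qw by simp
  qed

  \<comment> \<open>\<open>R_path4\<close> gives a defect of -p, the sign for a single vertex is -1,
    and the generic vertices have total weight about x: a contribution +xp.\<close>
  have g1: "\<bar>(\<Sum>W\<in>subsets_card ?G 1. ?h W) - p * (real (card ?G choose 1) * (p\<^sup>2) ^ 1)\<bar>
    \<le> 12000 * (x * p + x ^ 3 + p\<^sup>2) * x ^ 1"
  proof (rule sum_subsets_card_approx[OF fG(1,2)])
    show "0 \<le> 12000 * (x * p + x ^ 3 + p\<^sup>2)" using x_nonneg p_nonneg by simp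
    fix W assume W: "W \<subseteq> ?G" "card W = 1"
    then obtain z where z: "W = {z}" by (auto simp: card_1_singleton_iff)
    have ch: "cherries u v {z} = {{u, z}, {v, z}}" by (simp add: cherries_def)
    have "?F \<union> cherries u v W = {{v, w}, {u, z}, {v, z}}" by (auto simp: z ch)
    moreover have "\<bar>R {{v, w}, {u, z}, {v, z}} - R {{u, z}, {v, z}} * R {{v, w}} + p\<bar>
        \<le> 12000 * (x * p + x ^ 3 + p\<^sup>2)"
      using Gprops[of z] W z lt by (intro R_path4) auto
    ultimately have le: "\<bar>R (?F \<union> cherries u v W) - R ?F * R (cherries u v W) + p\<bar>
        \<le> 12000 * (x * p + x ^ 3 + p\<^sup>2)" by (simp add: z ch mult.commute)
    have "?h W - p * (p\<^sup>2) ^ 1 = - ((R (?F \<union> cherries u v W) - R ?F * R (cherries u v W) + p) * (p\<^sup>2) ^ 1)"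
      unfolding diff_term_generic[OF uv W(1)] W(2) by (simp add: algebra_simps)
    then have "\<bar>?h W - p * (p\<^sup>2) ^ 1\<bar> = \<bar>R (?F \<union> cherries u v W) - R ?F * R (cherries u v W) + p\<bar> * (p\<^sup>2) ^ 1"
      by (simp only: abs_mult abs_minus_cancel) simp
    also have "\<dots> \<le> 12000 * (x * p + x ^ 3 + p\<^sup>2) * (p\<^sup>2) ^ 1"
      using le by (intro mult_right_mono) auto
    finally show "\<bar>?h W - p * (p\<^sup>2) ^ 1\<bar> \<le> 12000 * (x * p + x ^ 3 + p\<^sup>2) * (p\<^sup>2) ^ 1" .
  qed
  have g23: "\<bar>\<Sum>W\<in>subsets_card ?G k. ?h W\<bar> \<le> 7000 * (p + x\<^sup>2) * x ^ k" if "k \<le> 3" for k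
    using sum_diff_term_generic[OF uv lt(1,2) FE new TF, of k] that by simp
  have G: "\<bar>(\<Sum>W\<in>Pow ?G. ?h W) - (\<Sum>k<4. \<Sum>W\<in>subsets_card ?G k. ?h W)\<bar> \<le> 2 * 2 * x ^ 4"
  proof (rule sum_Pow_truncate[OF fG(1,2)])
    fix W assume "W \<subseteq> ?G"
    then show "\<bar>?h W\<bar> \<le> 2 * (p\<^sup>2) ^ card W"
      using abs_diff_term_le[of ?F u v W] prod_q_generic[OF uv, of W ?F] by simp
  qed simp
  have K4: "(\<Sum>k<4. \<Sum>W\<in>subsets_card ?G k. ?h W) = (\<Sum>W\<in>subsets_card ?G 1. ?h W)
      + (\<Sum>W\<in>subsets_card ?G 2. ?h W) + (\<Sum>W\<in>subsets_card ?G 3. ?h W)"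
    using subsets_card_0[OF fG(1)] by (simp add: eval_nat_numeral)
  have part1: "\<bar>(\<Sum>W\<in>Pow ?G. ?h W) - p * ?c\<bar> \<le> 4 * x ^ 4 + 12000 * (x * p + x ^ 3 + p\<^sup>2) * x
      + 7000 * (p + x\<^sup>2) * x ^ 2 + 7000 * (p + x\<^sup>2) * x ^ 3"
    using G g1 g23[of 2] g23[of 3] unfolding K4 by simp

  let ?h' = "\<lambda>W. ?h (insert w W)"
  \<comment> \<open>The two-edge path over \<open>w\<close> has \<open>R\<close> = 1 - 2x to first
    order and weight p, whence -p + 2xp.\<close>
  have h0: "\<bar>?h' {} + p - 2 * x * p\<bar> \<le> 2268 * (p + x\<^sup>2) * p + p\<^sup>2"
  proof -
    have ch: "?F \<union> cherries u v {w} = {{u, w}, {v, w}}" "cherries u v {w} = {{u, w}, {v, w}}"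
      by (auto simp: cherries_def)
    have c2: "card {{u, w}, {v, w}} = 2" using d by (simp add: doubleton_eq_iff)
    have "triangle_free {{u, w}, {v, w}}"
      by (rule triangle_free_bipartite[where A = "{w}"]) (use d in \<open>auto simp: doubleton_eq_iff\<close>)
    then have "\<bar>R {{u, w}, {v, w}} - (1 - real (card {{u, w}, {v, w}}) * x)\<bar> \<le> 2268 * (p + x\<^sup>2)"
      using d lt c2 by (intro R_first_order) auto
    then have "\<bar>R {{u, w}, {v, w}} - (1 - 2 * x)\<bar> * p \<le> 2268 * (p + x\<^sup>2) * p"
      unfolding c2 using p_nonneg by (intro mult_right_mono) auto
    moreover have "\<bar>R {{u, w}, {v, w}} - (1 - 2 * x)\<bar> * p = \<bar>p * R {{u, w}, {v, w}} - p + 2 * x * p\<bar>"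
      using p_nonneg by (subst abs_mult_pos) (auto simp: algebra_simps)
    ultimately show ?thesis
      using p2_mult_R_bounds[of ?F "{{u, w}, {v, w}}"] by (auto simp: diff_term_singleton qw ch)
  qed
  \<comment> \<open>The pair \<open>{w, z}\<close> has positive sign and weight p * p^2, and the
    \<open>R\<close> of its 4-cycle is close to 1. Summed over \<open>z\<close> this is +xp.\<close>
  have h1: "\<bar>(\<Sum>W\<in>subsets_card ?G 1. ?h' W) - p * (real (card ?G choose 1) * (p\<^sup>2) ^ 1)\<bar>
    \<le> (250 * (x + p) * p + p\<^sup>2) * x ^ 1"
  proof (rule sum_subsets_card_approx[OF fG(1,2)])
    show "0 \<le> 250 * (x + p) * p + p\<^sup>2" using x_nonneg p_nonneg by simp
    fix W assume W: "W \<subseteq> ?G" "card W = 1"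
    then obtain z where z: "W = {z}" by (auto simp: card_1_singleton_iff)
    have dz: "z < n" "distinct [u, v, w, z]" using Gprops[of z] W z by auto
    let ?C = "{{u, w}, {v, w}, {u, z}, {v, z}}"
    have ch: "?F \<union> cherries u v {w, z} = ?C" "cherries u v {w, z} = ?C" by (auto simp: cherries_def)
    have "triangle_free ?C"
      by (rule triangle_free_bipartite[where A = "{u, v}"]) (use dz in \<open>auto simp: doubleton_eq_iff\<close>)
    then have "\<bar>R ?C - 1\<bar> \<le> 250 * (x + p)"
    proof (intro R_close_1)
      have "card ?C \<le> 4" using card_length[of "[{u, w}, {v, w}, {u, z}, {v, z}]"] by simp
      then show "card ?C \<le> 10" by simp
    qed (use dz lt in auto)
    then have "\<bar>R ?C - 1\<bar> * (p * p\<^sup>2) \<le> 250 * (x + p) * (p * p\<^sup>2)"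
      using p_nonneg by (intro mult_right_mono) auto
    moreover have "\<bar>R ?C - 1\<bar> * (p * p\<^sup>2) = \<bar>p * p\<^sup>2 * R ?C - p * p\<^sup>2\<bar>"
      using p_nonneg by (subst abs_mult_pos) (auto simp: algebra_simps)
    moreover have "?h' W = p * p\<^sup>2 * R ?C - p\<^sup>2 * (p\<^sup>2 * (R ?F * R ?C))"
    proof -
      have "card {w, z} = 2" using dz by simp
      then show ?thesis
        using prod_ins[OF W(1)] W(2) ch by (simp add: diff_term_def z power2_eq_square)
    qed
    moreover have "p\<^sup>2 * (p\<^sup>2 * (R ?F * R ?C)) \<le> p\<^sup>2 * p\<^sup>2" "0 \<le> p\<^sup>2 * (p\<^sup>2 * (R ?F * R ?C))"
      by (rule mult_left_mono[OF p2_mult_R_bounds(2)] mult_nonneg_nonneg[OF _ p2_mult_R_bounds(1)], simp)+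
    ultimately have "\<bar>?h' W - p * p\<^sup>2\<bar> \<le> 250 * (x + p) * (p * p\<^sup>2) + p\<^sup>2 * p\<^sup>2" by linarith
    then show "\<bar>?h' W - p * (p\<^sup>2) ^ 1\<bar> \<le> (250 * (x + p) * p + p\<^sup>2) * (p\<^sup>2) ^ 1"
      by (simp add: algebra_simps)
  qed
  have H: "\<bar>(\<Sum>W\<in>Pow ?G. ?h' W) - (\<Sum>k<2. \<Sum>W\<in>subsets_card ?G k. ?h' W)\<bar> \<le> 2 * (2 * p) * x ^ 2"
  proof (rule sum_Pow_truncate[OF fG(1,2)])
    show "0 \<le> 2 * p" using p_nonneg by simp
    fix W assume "W \<subseteq> ?G"
    then show "\<bar>?h' W\<bar> \<le> 2 * p * (p\<^sup>2) ^ card W"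
      using abs_diff_term_le[of ?F u v "insert w W"] prod_ins[of W] by simp
  qed
  have K2: "(\<Sum>k<2. \<Sum>W\<in>subsets_card ?G k. ?h' W) = ?h' {} + (\<Sum>W\<in>subsets_card ?G 1. ?h' W)"
    using subsets_card_0[OF fG(1)] by (simp add: eval_nat_numeral)
  have part2: "\<bar>(\<Sum>W\<in>Pow ?G. ?h' W) + p - 2 * x * p - p * ?c\<bar> \<le> 4 * p * x\<^sup>2
      + (2268 * (p + x\<^sup>2) * p + p\<^sup>2) + (250 * (x + p) * p + p\<^sup>2) * x"
    using H h0 h1 unfolding K2 by simp

  have "\<bar>?c - x\<bar> * (2 * p) \<le> 20 * p\<^sup>2 * (2 * p)"
    using card_generic[OF lt(1,2) uv FE] p_nonneg by (intro mult_right_mono) auto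
  moreover have "\<bar>?c - x\<bar> * (2 * p) = \<bar>2 * (p * ?c) - 2 * x * p\<bar>"
    using p_nonneg by (subst abs_mult_pos) (auto simp: algebra_simps)
  ultimately have c: "\<bar>2 * (p * ?c) - 2 * x * p\<bar> \<le> 20 * p\<^sup>2 * (2 * p)" by linarith
  have tot: "R {{u, v}, {v, w}} - R {{v, w}} * R {{u, v}} = (\<Sum>W\<in>Pow ?G. ?h W) + (\<Sum>W\<in>Pow ?G. ?h' W)"
    using R_insert_diff_term[OF uv lt(1,2) FE] arg_cong[OF U, of "\<lambda>S. sum ?h (Pow S)"]
      sum_Pow_insert[OF fG(1,3), of ?h] by linarith
  define err where "err = 4 * x ^ 4 + 12000 * (x * p + x ^ 3 + p\<^sup>2) * x
      + 7000 * (p + x\<^sup>2) * x ^ 2 + 7000 * (p + x\<^sup>2) * x ^ 3 + 4 * p * x\<^sup>2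
      + (2268 * (p + x\<^sup>2) * p + p\<^sup>2) + (250 * (x + p) * p + p\<^sup>2) * x + 20 * p\<^sup>2 * (2 * p)"
  have "\<bar>R {{u, v}, {v, w}} - R {{v, w}} * R {{u, v}} + p - 4 * x * p\<bar> \<le> err"
    unfolding tot err_def using part1 part2 c by linarith
  also have "err \<le> 30000 * (x\<^sup>2 * p + p\<^sup>2 + x ^ 4)"
  proof -
    have e: "err = 19004 * x ^ 4 + 21522 * (x\<^sup>2 * p) + 12251 * (x * p\<^sup>2) + 7000 * (x * (x\<^sup>2 * p))
      + 7000 * (x * x ^ 4) + 2269 * p\<^sup>2 + 40 * (p * p\<^sup>2)"
      unfolding err_def by (simp add: algebra_simps eval_nat_numeral)
    have s: "x * p\<^sup>2 \<le> 1 / 100 * p\<^sup>2" "x * (x\<^sup>2 * p) \<le> 1 / 100 * (x\<^sup>2 * p)" "x * x ^ 4 \<le> 1 / 100 * x ^ 4"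
      "p * p\<^sup>2 \<le> 1 / 100 * p\<^sup>2"
      by (rule mult_right_mono[OF x_small] mult_right_mono[OF p_small], use p_nonneg in simp)+
    have pos: "0 \<le> x\<^sup>2 * p" "0 \<le> p\<^sup>2" "0 \<le> x ^ 4" using p_nonneg by auto
    have "19004 * a + 21522 * b + 12251 * b' + 7000 * b'' + 7000 * a' + 2269 * c + 40 * c' \<le> 30000 * (b + c + a)"
      if "b' \<le> 1 / 100 * c" "b'' \<le> 1 / 100 * b" "a' \<le> 1 / 100 * a" "c' \<le> 1 / 100 * c"
        "0 \<le> b" "0 \<le> c" "0 \<le> a" for a a' b b' b'' c c' :: real
      using that by argo
    from this[OF s pos] show ?thesis unfolding e .
  qed
  finally show ?thesis .
qed

lemma R_single_edge_close_1:
  assumes "u \<noteq> v" "u < n" "v < n"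
  shows "\<bar>R {{u, v}} - 1\<bar> \<le> 25 * (x + p)"
proof -
  have "triangle_free {{u, v}}"
    by (rule triangle_free_bipartite[where A = "{u}"]) (use assms in \<open>auto simp: doubleton_eq_iff\<close>)
  then show ?thesis using R_insert_close[OF assms, of "{}"] by simp
qed

text \<open>The cycle is built edge by edge. The second and the third edge cost p each, the fourth
  nothing, hence -2p; the powers of r multiplying these p are close to 1.\<close>

lemma R_cycle4_edge:
  assumes d: "distinct [u, v, w, z]" and lt: "u < n" "v < n" "w < n" "z < n"
  shows "\<bar>R {{u, w}, {v, w}, {u, z}, {v, z}} - (R {{u, v}} ^ 4 - 2 * p)\<bar>
    \<le> 40000 * (x * p + x ^ 3 + p\<^sup>2)"
proof -
  define r where "r = R {{u, v}}"
  let ?e = "x * p + x ^ 3 + p\<^sup>2"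
  have e: "R {{a, b}} = r" if "a \<noteq> b" "a < n" "b < n" for a b
    unfolding r_def using that d lt by (intro R_edge) auto
  define a b c where "a = R {{v, z}, {u, z}}" and "b = R {{v, w}, {u, z}, {v, z}}"
    and "c = R {{u, w}, {v, w}, {u, z}, {v, z}}"
  have 1: "\<bar>a - r * r + p\<bar> \<le> 12000 * ?e"
    using R_path3[of u v z] d lt e by (simp add: a_def)
  have "{{u, z}, {v, z}} = {{v, z}, {u, z}}" by auto
  then have 2: "\<bar>b - a * r + p\<bar> \<le> 12000 * ?e"
    using R_path4[OF d lt] d lt e by (simp add: a_def b_def)
  have 3: "\<bar>c - b * r\<bar> \<le> 12000 * ?e"
    using R_cycle4[OF d lt] d lt e by (simp add: b_def c_def)
  have r: "0 \<le> r" "r \<le> 1" unfolding r_def by (rule R_nonneg R_le_1)+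
  have r1: "\<bar>r - 1\<bar> \<le> 25 * (x + p)" unfolding r_def using d lt by (intro R_single_edge_close_1) auto
  have E0: "0 \<le> 12000 * ?e" using x_nonneg p_nonneg by simp
  have m: "\<bar>y\<bar> * s \<le> 12000 * ?e" if "\<bar>y\<bar> \<le> 12000 * ?e" "0 \<le> s" "s \<le> 1" for y s
    using mult_mono[OF that(1,3)] that E0 by simp
  \<comment> \<open>The three approximations are substituted into each other; the last term replaces
    the correction r^2 p + r p by 2p.\<close>
  have "c - (r ^ 4 - 2 * p) = (c - b * r) + (b - a * r + p) * r + (a - r * r + p) * r\<^sup>2 - ((r + 2) * (r - 1)) * p"
    by (simp add: algebra_simps power2_eq_square eval_nat_numeral)
  moreover have "\<bar>(b - a * r + p) * r\<bar> \<le> 12000 * ?e"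
    unfolding abs_mult using m[OF 2 r] r by simp
  moreover have "\<bar>(a - r * r + p) * r\<^sup>2\<bar> \<le> 12000 * ?e"
    unfolding abs_mult using m[OF 1, of "r\<^sup>2"] r by (simp add: power_le_one)
  moreover have "\<bar>((r + 2) * (r - 1)) * p\<bar> \<le> (3 * (25 * (x + p))) * p"
    unfolding abs_mult using r r1 p_nonneg by (intro mult_mono) auto
  ultimately have "\<bar>c - (r ^ 4 - 2 * p)\<bar> \<le> 36000 * ?e + 75 * (x * p) + 75 * p\<^sup>2"
    using 3 by (simp add: algebra_simps power2_eq_square)
  moreover have "0 \<le> x * p" "0 \<le> x ^ 3" "0 \<le> p\<^sup>2" using x_nonneg p_nonneg by auto
  ultimately have "\<bar>c - (r ^ 4 - 2 * p)\<bar> \<le> 40000 * ?e" by argo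
  then show ?thesis by (simp add: c_def r_def)
qed

section \<open>The polynomial equation for \<open>R\<close> of a single edge\<close>

lemma binomial_bounds:
  assumes "2 \<le> n"
  shows "\<bar>real (n - 2 choose 1) * (p\<^sup>2) ^ 1 - (x - 2 * p\<^sup>2)\<bar> = 0"
    "\<bar>real (n - 2 choose 2) * (p\<^sup>2) ^ 2 - x\<^sup>2 / 2\<bar> \<le> 5 * (x * p\<^sup>2)"
    "\<bar>real (n - 2 choose 3) * (p\<^sup>2) ^ 3 - x ^ 3 / 6\<bar> \<le> 5 * (x\<^sup>2 * p\<^sup>2)"
    "\<bar>real (n - 2 choose 4) * (p\<^sup>2) ^ 4 - x ^ 4 / 24\<bar> \<le> 5 * (x ^ 3 * p\<^sup>2)"
proof -
  define m where "m = real n"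
  have m: "2 \<le> m" "real (n - 2) = m - 2" using assms by (auto simp: m_def)
  have x: "x = m * p\<^sup>2" by (simp add: x_def m_def)
  have m2: "2 * m \<le> m\<^sup>2" using m by (simp add: power2_eq_square)
  have m3: "2 * m\<^sup>2 \<le> m ^ 3" using mult_right_mono[OF m(1), of "m\<^sup>2"] by (simp add: power2_eq_square power3_eq_cube)
  \<comment> \<open>At size 1 the shift from n to n - 2 is visible and kept exactly as -2p^2. For
    larger sizes it costs only O(x^(k-1) p^2), which lies within the admissible error.\<close>
  show "\<bar>real (n - 2 choose 1) * (p\<^sup>2) ^ 1 - (x - 2 * p\<^sup>2)\<bar> = 0"
    by (simp add: x m(2) left_diff_distrib)
  \<comment> \<open>The generalized binomial is a polynomial in \<open>m\<close>, also when
    \<open>n - 2 < k\<close>.\<close>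
  have bg: "real (n - 2 choose k) = (m - 2) gchoose k" for k
    using binomial_gbinomial[of "n - 2" k, where 'a = real] unfolding m(2) .
  have b2: "real (n - 2 choose 2) = (m\<^sup>2 - 5 * m + 6) / 2"
    unfolding bg by (simp add: gbinomial_prod_rev eval_nat_numeral field_simps)
  have b3: "real (n - 2 choose 3) = (m ^ 3 - 9 * m\<^sup>2 + 26 * m - 24) / 6"
    unfolding bg by (simp add: gbinomial_prod_rev eval_nat_numeral field_simps)
  have b4: "real (n - 2 choose 4) = (m ^ 4 - 14 * m ^ 3 + 71 * m\<^sup>2 - 154 * m + 120) / 24"
    unfolding bg by (simp add: gbinomial_prod_rev eval_nat_numeral field_simps)
  have gen: "\<bar>b * (p\<^sup>2) ^ Suc k - x ^ Suc k / f\<bar> \<le> 5 * (x ^ k * p\<^sup>2)"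
    if "\<bar>b - m ^ Suc k / f\<bar> \<le> 5 * m ^ k" for b f :: real and k
  proof -
    have "b * (p\<^sup>2) ^ Suc k - x ^ Suc k / f = (b - m ^ Suc k / f) * (p\<^sup>2) ^ Suc k"
      by (simp only: x power_mult_distrib) (simp add: algebra_simps)
    then have "\<bar>b * (p\<^sup>2) ^ Suc k - x ^ Suc k / f\<bar> = \<bar>b - m ^ Suc k / f\<bar> * (p\<^sup>2) ^ Suc k"
      by (simp add: abs_mult)
    also have "\<dots> \<le> 5 * m ^ k * (p\<^sup>2) ^ Suc k" using that by (intro mult_right_mono) auto
    also have "\<dots> = 5 * (x ^ k * p\<^sup>2)" by (simp only: x power_mult_distrib) (simp add: algebra_simps)
    finally show ?thesis .
  qed
  show "\<bar>real (n - 2 choose 2) * (p\<^sup>2) ^ 2 - x\<^sup>2 / 2\<bar> \<le> 5 * (x * p\<^sup>2)"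
    using gen[of "real (n - 2 choose 2)" 1 2] m unfolding b2 by (simp add: abs_if numeral_2_eq_2 field_simps)
  show "\<bar>real (n - 2 choose 3) * (p\<^sup>2) ^ 3 - x ^ 3 / 6\<bar> \<le> 5 * (x\<^sup>2 * p\<^sup>2)"
  proof -
    have "\<bar>real (n - 2 choose 3) - m ^ Suc 2 / 6\<bar> \<le> 5 * m ^ 2"
    proof -
      have "real (n - 2 choose 3) - m ^ Suc 2 / 6 = (- 9 * m\<^sup>2 + 26 * m - 24) / 6"
        unfolding b3 by (simp add: field_simps eval_nat_numeral)
      then show ?thesis using m(1) m2 by (simp add: abs_le_iff)
    qed
    from gen[OF this] show ?thesis by (simp add: eval_nat_numeral)
  qed
  show "\<bar>real (n - 2 choose 4) * (p\<^sup>2) ^ 4 - x ^ 4 / 24\<bar> \<le> 5 * (x ^ 3 * p\<^sup>2)"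
  proof -
    have "\<bar>real (n - 2 choose 4) - m ^ Suc 3 / 24\<bar> \<le> 5 * m ^ 3"
    proof -
      have "real (n - 2 choose 4) - m ^ Suc 3 / 24 = (- 14 * m ^ 3 + 71 * m\<^sup>2 - 154 * m + 120) / 24"
        unfolding b4 by (simp add: field_simps eval_nat_numeral)
      then show ?thesis using m(1) m2 m3 by (simp add: abs_le_iff)
    qed
    from gen[OF this] show ?thesis by (simp add: eval_nat_numeral)
  qed
qed

end

text \<open>\<open>s\<close> is almost a fixed point of a map \<Phi> with Lipschitz constant 1/2. It
  suffices that the explicit polynomial \<open>a\<close> is one too, up to \<open>300 * err\<close>:
  then |s - a| is at most |s - a|/2 + (C + 300) err. The pure powers of x in \<open>a\<close> have
  coefficients (2k+1)^(k-1)/k! with alternating signs; they come from Lagrange inversion of r = exp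
  (- x r^2).\<close>

lemma edge_equation_solution:
  fixes x p s C :: real
  defines "err \<equiv> x ^ 5 + x ^ 3 * p + x * p\<^sup>2 + p ^ 3"
    and "a \<equiv> x - 5 / 2 * x\<^sup>2 + 49 / 6 * x ^ 3 - 243 / 8 * x ^ 4 - x * p + 7 * x\<^sup>2 * p - 2 * p\<^sup>2"
  assumes x: "0 \<le> x" "x \<le> 1 / 100" and p: "0 \<le> p" "p \<le> 1 / 100" and s: "0 \<le> s" "s \<le> 1"
    and eq: "\<bar>s - (x * (1 - s)\<^sup>2 - 2 * p\<^sup>2 - x * p + 5 * x\<^sup>2 * p - x\<^sup>2 / 2 * (1 - s) ^ 4
      + x ^ 3 / 6 * (1 - 6 * x) - x ^ 4 / 24)\<bar> \<le> C * err"
  shows "\<bar>s - a\<bar> \<le> 2 * (C + 300) * err"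
proof -
  define \<Phi> where "\<Phi> t = x * (1 - t)\<^sup>2 - 2 * p\<^sup>2 - x * p + 5 * x\<^sup>2 * p - x\<^sup>2 / 2 * (1 - t) ^ 4
      + x ^ 3 / 6 * (1 - 6 * x) - x ^ 4 / 24" for t
  \<comment> \<open>In \<Phi>, higher powers of \<open>a\<close> come with higher order, so shorter
    truncations of \<open>a\<close> suffice there: error \<open>d1\<close> in the term -2xa,
    \<open>d2\<close> relative to \<open>y\<close> in x a^2 and 2 x^2 a, and just x in 3 x^2 a^2.
    The 25/4 x^5 is the top term of x y^2.\<close>
  define y where "y = x - 5 / 2 * x\<^sup>2"
  define d1 where "d1 = a - (y + 49 / 6 * x ^ 3 - x * p)"
  define d2 where "d2 = a - y"
  have err: "0 \<le> err" using x p by (simp add: err_def)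
  have nn: "0 \<le> x ^ i * p ^ j" for i j using x p by simp
  have red: "x ^ Suc i * p ^ j \<le> x ^ i * p ^ j / 100" "x ^ i * p ^ Suc j \<le> x ^ i * p ^ j / 100" for i j
    using mult_right_mono[OF x(2) nn[of i j]] mult_right_mono[OF p(2) nn[of i j]] by (simp_all add: mult_ac)
  have x2: "x\<^sup>2 \<le> x / 100" using red(1)[of 1 0] by (simp add: power2_eq_square)
  have x3: "x ^ 3 \<le> x\<^sup>2 / 100" using red(1)[of 2 0] by (simp add: eval_nat_numeral)
  have x4: "x ^ 4 \<le> x ^ 3 / 100" using red(1)[of 3 0] by (simp add: eval_nat_numeral)
  have x2p: "x\<^sup>2 * p \<le> x * p / 100" using red(1)[of 1 1] by (simp add: eval_nat_numeral)
  have xp: "x * p \<le> x / 100" using red(2)[of 1 0] by (simp add: eval_nat_numeral)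
  have p2: "p\<^sup>2 \<le> p / 100" using red(2)[of 0 1] by (simp add: eval_nat_numeral)
  have pos: "0 \<le> x\<^sup>2" "0 \<le> x ^ 3" "0 \<le> x ^ 4" "0 \<le> x * p" "0 \<le> x\<^sup>2 * p" "0 \<le> p\<^sup>2" using x p by auto
  have d1: "\<bar>d1\<bar> \<le> 31 * x ^ 4 + 7 * (x\<^sup>2 * p) + 2 * p\<^sup>2"
    using pos unfolding d1_def y_def a_def by linarith
  have d2: "\<bar>d2\<bar> \<le> 9 * x ^ 3 + 2 * (x * p) + 2 * p\<^sup>2"
    using pos x4 x2p unfolding d2_def y_def a_def by linarith
  have ax: "\<bar>a - x\<bar> \<le> 3 * x\<^sup>2 + 2 * (x * p) + 2 * p\<^sup>2"
    using d2 pos x3 unfolding d2_def y_def by linarith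
  have a: "\<bar>a\<bar> \<le> 2 * x + p" "\<bar>a + x\<bar> \<le> 3 * x + p" "\<bar>a + y\<bar> \<le> 3 * x + p"
    using ax pos x2 xp p2 x p unfolding y_def by linarith+
  have t1: "\<bar>2 * x * d1\<bar> \<le> 62 * x ^ 5 + 14 * (x ^ 3 * p) + 4 * (x * p\<^sup>2)"
  proof -
    have "\<bar>2 * x * d1\<bar> \<le> (2 * x) * (31 * x ^ 4 + 7 * (x\<^sup>2 * p) + 2 * p\<^sup>2)"
      unfolding abs_mult using d1 x by (intro mult_mono) auto
    also have "\<dots> = 62 * x ^ 5 + 14 * (x ^ 3 * p) + 4 * (x * p\<^sup>2)"
      by (simp add: algebra_simps eval_nat_numeral)
    finally show ?thesis .
  qed
  have t2: "\<bar>x * (d2 * (a + y))\<bar> \<le> 27 * x ^ 5 + 9 * (x ^ 4 * p) + 6 * (x ^ 3 * p) + 8 * (x\<^sup>2 * p\<^sup>2) + 2 * (x * p ^ 3)"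
  proof -
    have "\<bar>x * (d2 * (a + y))\<bar> \<le> x * ((9 * x ^ 3 + 2 * (x * p) + 2 * p\<^sup>2) * (3 * x + p))"
      unfolding abs_mult using d2 a x p by (intro mult_mono) auto
    also have "\<dots> = 27 * x ^ 5 + 9 * (x ^ 4 * p) + 6 * (x ^ 3 * p) + 8 * (x\<^sup>2 * p\<^sup>2) + 2 * (x * p ^ 3)"
      by (simp add: algebra_simps eval_nat_numeral)
    finally show ?thesis .
  qed
  have t3: "\<bar>2 * x\<^sup>2 * d2\<bar> \<le> 18 * x ^ 5 + 4 * (x ^ 3 * p) + 4 * (x\<^sup>2 * p\<^sup>2)"
  proof -
    have "\<bar>2 * x\<^sup>2 * d2\<bar> \<le> (2 * x\<^sup>2) * (9 * x ^ 3 + 2 * (x * p) + 2 * p\<^sup>2)"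
      unfolding abs_mult using d2 x by (intro mult_mono) auto
    also have "\<dots> = 18 * x ^ 5 + 4 * (x ^ 3 * p) + 4 * (x\<^sup>2 * p\<^sup>2)"
      by (simp add: algebra_simps eval_nat_numeral)
    finally show ?thesis .
  qed
  have t4: "\<bar>3 * x\<^sup>2 * ((a - x) * (a + x))\<bar> \<le>
      27 * x ^ 5 + 27 * (x ^ 4 * p) + 24 * (x ^ 3 * p\<^sup>2) + 6 * (x\<^sup>2 * p ^ 3)"
  proof -
    have "\<bar>3 * x\<^sup>2 * ((a - x) * (a + x))\<bar> \<le> (3 * x\<^sup>2) * ((3 * x\<^sup>2 + 2 * (x * p) + 2 * p\<^sup>2) * (3 * x + p))"
      unfolding abs_mult using ax a x p by (intro mult_mono) auto
    also have "\<dots> = 27 * x ^ 5 + 27 * (x ^ 4 * p) + 24 * (x ^ 3 * p\<^sup>2) + 6 * (x\<^sup>2 * p ^ 3)"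
      by (simp add: algebra_simps eval_nat_numeral)
    finally show ?thesis .
  qed
  have t5: "\<bar>x\<^sup>2 * (a ^ 3 * (2 - a / 2))\<bar> \<le> 24 * x ^ 5 + 36 * (x ^ 4 * p) + 18 * (x ^ 3 * p\<^sup>2) + 3 * (x\<^sup>2 * p ^ 3)"
  proof -
    have "\<bar>a ^ 3\<bar> \<le> (2 * x + p) ^ 3" unfolding power_abs using a by (intro power_mono) auto
    moreover have "\<bar>2 - a / 2\<bar> \<le> 3" using a x p by auto
    ultimately have "\<bar>x\<^sup>2 * (a ^ 3 * (2 - a / 2))\<bar> \<le> x\<^sup>2 * ((2 * x + p) ^ 3 * 3)"
      unfolding abs_mult using x p by (intro mult_mono) auto
    also have "\<dots> = 24 * x ^ 5 + 36 * (x ^ 4 * p) + 18 * (x ^ 3 * p\<^sup>2) + 3 * (x\<^sup>2 * p ^ 3)"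
      by (simp add: algebra_simps eval_nat_numeral)
    finally show ?thesis .
  qed
  have "\<Phi> a - a = - (2 * x * d1) + x * (d2 * (a + y)) + 25 / 4 * x ^ 5
      + 2 * x\<^sup>2 * d2 - 3 * x\<^sup>2 * ((a - x) * (a + x)) + x\<^sup>2 * (a ^ 3 * (2 - a / 2))"
  proof -
    have "\<Phi> b - (y + 49 / 6 * x ^ 3 - 243 / 8 * x ^ 4 - x * p + 7 * x\<^sup>2 * p - 2 * p\<^sup>2) =
      - (2 * x * (b - (y + 49 / 6 * x ^ 3 - x * p))) + x * ((b - y) * (b + y)) + 25 / 4 * x ^ 5
      + 2 * x\<^sup>2 * (b - y) - 3 * x\<^sup>2 * ((b - x) * (b + x)) + x\<^sup>2 * (b ^ 3 * (2 - b / 2))" for b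
      unfolding \<Phi>_def y_def by (simp add: field_simps eval_nat_numeral)
    from this[of a] show ?thesis unfolding d1_def d2_def y_def a_def by simp
  qed
  then have "\<bar>\<Phi> a - a\<bar> \<le> \<bar>2 * x * d1\<bar> + \<bar>x * (d2 * (a + y))\<bar> + 25 / 4 * x ^ 5
      + \<bar>2 * x\<^sup>2 * d2\<bar> + \<bar>3 * x\<^sup>2 * ((a - x) * (a + x))\<bar> + \<bar>x\<^sup>2 * (a ^ 3 * (2 - a / 2))\<bar>"
    using x zero_le_power[OF x(1), of 5] by linarith
  also have "\<dots> \<le> 165 * x ^ 5 + 72 * (x ^ 4 * p) + 24 * (x ^ 3 * p) + 42 * (x ^ 3 * p\<^sup>2)
      + 12 * (x\<^sup>2 * p\<^sup>2) + 9 * (x\<^sup>2 * p ^ 3) + 2 * (x * p ^ 3) + 4 * (x * p\<^sup>2)"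
    using t1 t2 t3 t4 t5 zero_le_power[OF x(1), of 5] by linarith
  also have "\<dots> \<le> 300 * err"
  proof -
    have small: "x ^ 4 * p \<le> x ^ 3 * p" "x ^ 3 * p\<^sup>2 \<le> x ^ 3 * p" "x\<^sup>2 * p\<^sup>2 \<le> x * p\<^sup>2"
      "x\<^sup>2 * p ^ 3 \<le> x * p ^ 3" "x * p ^ 3 \<le> x * p\<^sup>2"
      using x p by (auto intro!: mult_left_mono mult_right_mono simp: power_decreasing_iff eval_nat_numeral mult_left_le_one_le)
    have pos: "0 \<le> x ^ 5" "0 \<le> x ^ 3 * p" "0 \<le> x * p\<^sup>2" "0 \<le> p ^ 3" using x p by auto
    have "165 * a + 72 * b' + 24 * b + 42 * b'' + 12 * c' + 9 * d' + 2 * d + 4 * c \<le> 300 * (a + b + c + e)"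
      if "b' \<le> b" "b'' \<le> b" "c' \<le> c" "d' \<le> d" "d \<le> c" "0 \<le> a" "0 \<le> b" "0 \<le> c" "0 \<le> e"
      for a b b' b'' c c' d d' e :: real
      using that by argo
    from this[OF small pos] show ?thesis unfolding err_def .
  qed
  finally have fixp: "\<bar>\<Phi> a - a\<bar> \<le> 300 * err" .
  \<comment> \<open>Both summands of the difference quotient carry a factor x, at most 1/100, which
    yields the contraction.\<close>
  have "\<Phi> s - \<Phi> a = (s - a) * (- x * (2 - s - a) + x * (x / 2 * (((1 - s)\<^sup>2 + (1 - a)\<^sup>2) * (2 - s - a))))"
    unfolding \<Phi>_def by (simp add: field_simps eval_nat_numeral)
  also have "\<bar>\<dots>\<bar> \<le> \<bar>s - a\<bar> * (1 / 2)"
    unfolding abs_mult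
  proof (intro mult_left_mono)
    have a1: "\<bar>a\<bar> \<le> 1" using a x p by auto
    have b1: "\<bar>2 - s - a\<bar> \<le> 3" using a1 s by auto
    have "(1 - s)\<^sup>2 \<le> 1" using s by (simp add: power_le_one)
    moreover have "(1 - a)\<^sup>2 \<le> 2\<^sup>2" using a1 by (intro power2_le_iff_abs_le[THEN iffD2]) auto
    ultimately have b2: "\<bar>(1 - s)\<^sup>2 + (1 - a)\<^sup>2\<bar> \<le> 5" by simp
    have "\<bar>((1 - s)\<^sup>2 + (1 - a)\<^sup>2) * (2 - s - a)\<bar> \<le> 5 * 3"
      unfolding abs_mult using b1 b2 by (intro mult_mono) auto
    then have b3: "\<bar>x / 2 * (((1 - s)\<^sup>2 + (1 - a)\<^sup>2) * (2 - s - a))\<bar> \<le> 1 * (5 * 3)"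
      unfolding abs_mult[of "x / 2"] using x by (intro mult_mono) auto
    have "\<bar>x * (x / 2 * (((1 - s)\<^sup>2 + (1 - a)\<^sup>2) * (2 - s - a)))\<bar> \<le> 1 / 100 * (1 * (5 * 3))"
      unfolding abs_mult[of x] using b3 x by (intro mult_mono) auto
    moreover have "\<bar>- x * (2 - s - a)\<bar> \<le> 1 / 100 * 3"
      unfolding abs_mult using b1 x by (intro mult_mono) auto
    ultimately show "\<bar>- x * (2 - s - a) + x * (x / 2 * (((1 - s)\<^sup>2 + (1 - a)\<^sup>2) * (2 - s - a)))\<bar> \<le> 1 / 2"
      by linarith
  qed simp
  finally have "\<bar>s - a\<bar> \<le> \<bar>s - a\<bar> * (1 / 2) + 300 * err + C * err"
    using eq fixp unfolding \<Phi>_def[symmetric] by linarith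
  then show ?thesis by (simp add: algebra_simps)
qed

context sparse
begin

text \<open>One common neighbour gives the path, hence x r^2, -xp, 4 x^2 p and, from n - 2, the
  -2p^2. Two give the 4-cycle, hence x^2 r^4 / 2 and another x^2 p, for a total of 5 x^2 p. Three
  give six edges to first order, four give 1. Only where r needs higher accuracy does it stay
  unexpanded.\<close>

lemma edge_equation:
  assumes uv: "u \<noteq> v" "u < n" "v < n"
  defines "r \<equiv> R {{u, v}}"
  shows "\<bar>(1 - r) - (x * r\<^sup>2 - 2 * p\<^sup>2 - x * p + 5 * x\<^sup>2 * p - x\<^sup>2 / 2 * r ^ 4
      + x ^ 3 / 6 * (1 - 6 * x) - x ^ 4 / 24)\<bar> \<le> 80000 * (x ^ 5 + x ^ 3 * p + x * p\<^sup>2 + p ^ 3)"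
proof -
  let ?G = "V - {u, v}"
  define h where "h W = (-1) ^ card W * ((p\<^sup>2) ^ card W * R (cherries u v W))" for W
  define S where "S k = (\<Sum>W\<in>subsets_card ?G k. h W)" for k
  have n2: "2 \<le> n" using uv by auto
  have fG: "finite ?G" "card ?G = n - 2" using uv by (auto simp: card_Diff_subset)
  have cG: "card ?G \<le> n" using fG by simp
  have edge: "R {{a, b}} = r" if "a \<noteq> b" "a < n" "b < n" for a b
    unfolding r_def using that uv by (intro R_edge) auto
  have r: "0 \<le> r" "r \<le> 1" unfolding r_def by (rule R_nonneg R_le_1)+
  have r1: "\<bar>r - 1\<bar> \<le> 25 * (x + p)" unfolding r_def using uv by (intro R_single_edge_close_1) auto
  have C: "cherries u v W \<subseteq> E" "card (cherries u v W) = 2 * card W" "triangle_free (cherries u v W)"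
    if "W \<subseteq> ?G" for W
    using union_cherries_props[OF uv, of "{}" W] that by auto
  have approx: "\<bar>S k - (-1) ^ k * a * (real (n - 2 choose k) * (p\<^sup>2) ^ k)\<bar> \<le> b * x ^ k"
    if "0 \<le> b" "\<And>W. W \<subseteq> ?G \<Longrightarrow> card W = k \<Longrightarrow> \<bar>R (cherries u v W) - a\<bar> \<le> b" for a b k
    unfolding S_def fG(2)[symmetric]
  proof (rule sum_subsets_card_approx[OF fG(1) cG that(1)])
    fix W assume W: "W \<subseteq> ?G" "card W = k"
    have "h W - (-1) ^ k * a * (p\<^sup>2) ^ k = ((-1) ^ k * (R (cherries u v W) - a)) * (p\<^sup>2) ^ k"
      using W by (simp add: h_def algebra_simps)
    then have "\<bar>h W - (-1) ^ k * a * (p\<^sup>2) ^ k\<bar> = \<bar>R (cherries u v W) - a\<bar> * (p\<^sup>2) ^ k"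
      by (simp only: abs_mult) (simp add: power_abs)
    also have "\<dots> \<le> b * (p\<^sup>2) ^ k" using that(2)[OF W] by (intro mult_right_mono) auto
    finally show "\<bar>h W - (-1) ^ k * a * (p\<^sup>2) ^ k\<bar> \<le> b * (p\<^sup>2) ^ k" .
  qed
  have S1: "\<bar>S 1 - (-1) ^ 1 * (r\<^sup>2 - p + 4 * x * p) * (real (n - 2 choose 1) * (p\<^sup>2) ^ 1)\<bar>
      \<le> 30000 * (x\<^sup>2 * p + p\<^sup>2 + x ^ 4) * x ^ 1"
  proof (rule approx)
    show "0 \<le> 30000 * (x\<^sup>2 * p + p\<^sup>2 + x ^ 4)" using x_nonneg p_nonneg by simp
    fix W assume W: "W \<subseteq> ?G" "card W = 1"
    then obtain w where w: "W = {w}" by (auto simp: card_1_singleton_iff)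
    have d: "distinct [u, w, v]" "w < n" using W w uv by auto
    have "cherries u v W = {{u, w}, {w, v}}" by (auto simp: cherries_def w)
    then show "\<bar>R (cherries u v W) - (r\<^sup>2 - p + 4 * x * p)\<bar> \<le> 30000 * (x\<^sup>2 * p + p\<^sup>2 + x ^ 4)"
      using R_path3_fine[of u w v] d uv edge[of w v] edge[of u w] by (simp add: power2_eq_square algebra_simps)
  qed
  have S2: "\<bar>S 2 - (-1) ^ 2 * (r ^ 4 - 2 * p) * (real (n - 2 choose 2) * (p\<^sup>2) ^ 2)\<bar>
      \<le> 40000 * (x * p + x ^ 3 + p\<^sup>2) * x ^ 2"
  proof (rule approx)
    show "0 \<le> 40000 * (x * p + x ^ 3 + p\<^sup>2)" using x_nonneg p_nonneg by simp
    fix W assume W: "W \<subseteq> ?G" "card W = 2"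
    then obtain w z where w: "W = {w, z}" "w \<noteq> z" by (auto simp: card_2_iff)
    have d: "distinct [u, v, w, z]" "w < n" "z < n" using W w uv by auto
    have "cherries u v W = {{u, w}, {v, w}, {u, z}, {v, z}}" by (auto simp: cherries_def w)
    then show "\<bar>R (cherries u v W) - (r ^ 4 - 2 * p)\<bar> \<le> 40000 * (x * p + x ^ 3 + p\<^sup>2)"
      using R_cycle4_edge[of u v w z] d uv by (simp add: r_def)
  qed
  have S3: "\<bar>S 3 - (-1) ^ 3 * (1 - 6 * x) * (real (n - 2 choose 3) * (p\<^sup>2) ^ 3)\<bar> \<le> 2268 * (p + x\<^sup>2) * x ^ 3"
  proof (rule approx)
    show "0 \<le> 2268 * (p + x\<^sup>2)" using p_nonneg by simp
    fix W assume W: "W \<subseteq> ?G" "card W = 3"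
    show "\<bar>R (cherries u v W) - (1 - 6 * x)\<bar> \<le> 2268 * (p + x\<^sup>2)"
      using R_first_order[of "cherries u v W"] C[OF W(1)] W(2) by simp
  qed
  have S4: "\<bar>S 4 - (-1) ^ 4 * 1 * (real (n - 2 choose 4) * (p\<^sup>2) ^ 4)\<bar> \<le> 250 * (x + p) * x ^ 4"
  proof (rule approx)
    show "0 \<le> 250 * (x + p)" using p_nonneg x_nonneg by simp
    fix W assume W: "W \<subseteq> ?G" "card W = 4"
    show "\<bar>R (cherries u v W) - 1\<bar> \<le> 250 * (x + p)"
      using R_close_1[of "cherries u v W"] C[OF W(1)] W(2) by simp
  qed
  have "\<bar>(\<Sum>W\<in>Pow ?G. h W) - (\<Sum>k<5. \<Sum>W\<in>subsets_card ?G k. h W)\<bar> \<le> 2 * 1 * x ^ 5"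
  proof (rule sum_Pow_truncate[OF fG(1) cG])
    fix W
    show "\<bar>h W\<bar> \<le> 1 * (p\<^sup>2) ^ card W"
      using R_nonneg[of "cherries u v W"] R_le_1[of "cherries u v W"]
      by (simp add: h_def abs_mult power_abs mult_left_le)
  qed simp
  moreover have "(\<Sum>W\<in>Pow ?G. h W) = r" unfolding r_def R_single_edge[OF uv] h_def ..
  moreover have "(\<Sum>k<5. \<Sum>W\<in>subsets_card ?G k. h W) = 1 + S 1 + S 2 + S 3 + S 4"
  proof -
    have "S 0 = 1" using subsets_card_0[OF fG(1)] by (simp add: S_def h_def)
    then show ?thesis unfolding S_def[symmetric] by (simp add: eval_nat_numeral)
  qed
  ultimately have main: "\<bar>r - (1 + S 1 + S 2 + S 3 + S 4)\<bar> \<le> 2 * x ^ 5" by simp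
  note B = binomial_bounds[OF n2]
  have sg: "a - (-1) ^ 1 * b * c = a + b * c" "a - (-1) ^ 3 * b * c = a + b * c" for a b c :: real
    by simp_all
  \<comment> \<open>The shift n - 2 really yields -2 p^2 r^2; the power r^2 may be dropped because 1
    - r^2 = O(x + p).\<close>
  have T1: "\<bar>S 1 + (x * r\<^sup>2 - x * p + 4 * (x\<^sup>2 * p) - 2 * p\<^sup>2)\<bar>
      \<le> 30000 * (x ^ 3 * p + x * p\<^sup>2 + x ^ 5) + 100 * (x * p\<^sup>2) + 102 * p ^ 3 + 8 * (x * p ^ 3)"
  proof -
    have b: "real (n - 2 choose 1) * (p\<^sup>2) ^ 1 = x - 2 * p\<^sup>2" using B(1) by simp
    have "30000 * (x\<^sup>2 * p + p\<^sup>2 + x ^ 4) * x ^ 1 = 30000 * (x ^ 3 * p + x * p\<^sup>2 + x ^ 5)"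
      by (simp add: algebra_simps eval_nat_numeral)
    then have 1: "\<bar>S 1 + (r\<^sup>2 - p + 4 * x * p) * (x - 2 * p\<^sup>2)\<bar> \<le> 30000 * (x ^ 3 * p + x * p\<^sup>2 + x ^ 5)"
      using S1 unfolding b sg by simp
    have 2: "(r\<^sup>2 - p + 4 * x * p) * (x - 2 * p\<^sup>2) = (x * r\<^sup>2 - x * p + 4 * (x\<^sup>2 * p) - 2 * p\<^sup>2)
       + (2 * p\<^sup>2 * ((1 + r) * (1 - r)) + 2 * p ^ 3 - 8 * (x * p ^ 3))"
      by (simp add: algebra_simps eval_nat_numeral)
    have "\<bar>2 * p\<^sup>2 * ((1 + r) * (1 - r))\<bar> \<le> 2 * p\<^sup>2 * (2 * (25 * (x + p)))"
      unfolding abs_mult using r r1 by (intro mult_mono) auto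
    also have "\<dots> = 100 * (x * p\<^sup>2) + 100 * p ^ 3" by (simp add: algebra_simps eval_nat_numeral)
    finally have 3: "\<bar>2 * p\<^sup>2 * ((1 + r) * (1 - r))\<bar> \<le> 100 * (x * p\<^sup>2) + 100 * p ^ 3" .
    have "0 \<le> p ^ 3" "0 \<le> x * p ^ 3" using p_nonneg x_nonneg by auto
    then show ?thesis using 1 3 unfolding 2 by linarith
  qed
  have T2: "\<bar>S 2 - (x\<^sup>2 / 2 * r ^ 4 - x\<^sup>2 * p)\<bar> \<le> 40000 * (x ^ 3 * p + x ^ 5 + x\<^sup>2 * p\<^sup>2) + 5 * (x * p\<^sup>2)"
  proof -
    have "40000 * (x * p + x ^ 3 + p\<^sup>2) * x ^ 2 = 40000 * (x ^ 3 * p + x ^ 5 + x\<^sup>2 * p\<^sup>2)"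
      by (simp add: algebra_simps eval_nat_numeral)
    then have 1: "\<bar>S 2 - (r ^ 4 - 2 * p) * (real (n - 2 choose 2) * (p\<^sup>2) ^ 2)\<bar>
       \<le> 40000 * (x ^ 3 * p + x ^ 5 + x\<^sup>2 * p\<^sup>2)" using S2 by simp
    have "\<bar>r ^ 4 - 2 * p\<bar> \<le> 1"
      using power_le_one[OF r, of 4] zero_le_power[OF r(1), of 4] p_nonneg p_small by linarith
    then have "\<bar>(r ^ 4 - 2 * p) * (real (n - 2 choose 2) * (p\<^sup>2) ^ 2 - x\<^sup>2 / 2)\<bar> \<le> 1 * (5 * (x * p\<^sup>2))"
      unfolding abs_mult[of "r ^ 4 - 2 * p"] using B(2) by (intro mult_mono) auto
    moreover have "(r ^ 4 - 2 * p) * (real (n - 2 choose 2) * (p\<^sup>2) ^ 2 - x\<^sup>2 / 2) =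
       (r ^ 4 - 2 * p) * (real (n - 2 choose 2) * (p\<^sup>2) ^ 2) - (x\<^sup>2 / 2 * r ^ 4 - x\<^sup>2 * p)"
      by (simp add: algebra_simps)
    ultimately show ?thesis using 1 by linarith
  qed
  have T3: "\<bar>S 3 + x ^ 3 / 6 * (1 - 6 * x)\<bar> \<le> 2268 * (x ^ 3 * p + x ^ 5) + 5 * (x\<^sup>2 * p\<^sup>2)"
  proof -
    have "2268 * (p + x\<^sup>2) * x ^ 3 = 2268 * (x ^ 3 * p + x ^ 5)"
      by (simp add: algebra_simps eval_nat_numeral)
    then have 1: "\<bar>S 3 + (1 - 6 * x) * (real (n - 2 choose 3) * (p\<^sup>2) ^ 3)\<bar> \<le> 2268 * (x ^ 3 * p + x ^ 5)"
      using S3 unfolding sg by simp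
    have "\<bar>(1 - 6 * x) * (real (n - 2 choose 3) * (p\<^sup>2) ^ 3 - x ^ 3 / 6)\<bar> \<le> 1 * (5 * (x\<^sup>2 * p\<^sup>2))"
      unfolding abs_mult[of "1 - 6 * x"] using B(3) x_nonneg x_small by (intro mult_mono) auto
    moreover have "(1 - 6 * x) * (real (n - 2 choose 3) * (p\<^sup>2) ^ 3 - x ^ 3 / 6) =
      (1 - 6 * x) * (real (n - 2 choose 3) * (p\<^sup>2) ^ 3) - x ^ 3 / 6 * (1 - 6 * x)"
      by (simp add: algebra_simps)
    ultimately show ?thesis using 1 by linarith
  qed
  have T4: "\<bar>S 4 - x ^ 4 / 24\<bar> \<le> 250 * (x ^ 5 + x ^ 4 * p) + 5 * (x ^ 3 * p\<^sup>2)"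
  proof -
    have "250 * (x + p) * x ^ 4 = 250 * (x ^ 5 + x ^ 4 * p)"
      by (simp add: algebra_simps eval_nat_numeral)
    then show ?thesis using S4 B(4) by simp
  qed
  have small: "x ^ 4 * p \<le> x ^ 3 * p" "x ^ 3 * p\<^sup>2 \<le> x * p\<^sup>2" "x\<^sup>2 * p\<^sup>2 \<le> x * p\<^sup>2 / 100" "x * p ^ 3 \<le> x * p\<^sup>2"
  proof -
    have s: "0 \<le> x" "x \<le> 1" "0 \<le> p" "p \<le> 1" using x_nonneg x_small p_nonneg p_small by auto
    have "x ^ 4 \<le> x ^ 3" "x ^ 3 \<le> x ^ 1" "p ^ 3 \<le> p\<^sup>2" using power_decreasing[of 3 4 x] power_decreasing[of 1 3 x] power_decreasing[of 2 3 p] s by simp_all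
    then show "x ^ 4 * p \<le> x ^ 3 * p" "x ^ 3 * p\<^sup>2 \<le> x * p\<^sup>2" "x * p ^ 3 \<le> x * p\<^sup>2"
      using s by (auto intro!: mult_right_mono mult_left_mono)
    show "x\<^sup>2 * p\<^sup>2 \<le> x * p\<^sup>2 / 100"
      using mult_right_mono[OF x_small, of "x * p\<^sup>2"] s by (simp add: power2_eq_square mult_ac)
  qed
  have pos: "0 \<le> x ^ 5" "0 \<le> x ^ 3 * p" "0 \<le> x * p\<^sup>2" "0 \<le> p ^ 3" "0 \<le> x\<^sup>2 * p\<^sup>2" using x_nonneg p_nonneg by auto
  have eq: "(1 - r) - (x * r\<^sup>2 - 2 * p\<^sup>2 - x * p + 5 * x\<^sup>2 * p - x\<^sup>2 / 2 * r ^ 4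
      + x ^ 3 / 6 * (1 - 6 * x) - x ^ 4 / 24) =
    - (r - (1 + S 1 + S 2 + S 3 + S 4)) - (S 1 + (x * r\<^sup>2 - x * p + 4 * (x\<^sup>2 * p) - 2 * p\<^sup>2))
    - (S 2 - (x\<^sup>2 / 2 * r ^ 4 - x\<^sup>2 * p)) - (S 3 + x ^ 3 / 6 * (1 - 6 * x)) - (S 4 - x ^ 4 / 24)"
    by simp
  have "\<bar>(1 - r) - (x * r\<^sup>2 - 2 * p\<^sup>2 - x * p + 5 * x\<^sup>2 * p - x\<^sup>2 / 2 * r ^ 4
      + x ^ 3 / 6 * (1 - 6 * x) - x ^ 4 / 24)\<bar> \<le> 2 * x ^ 5
      + (30000 * (x ^ 3 * p + x * p\<^sup>2 + x ^ 5) + 100 * (x * p\<^sup>2) + 102 * p ^ 3 + 8 * (x * p ^ 3))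
      + (40000 * (x ^ 3 * p + x ^ 5 + x\<^sup>2 * p\<^sup>2) + 5 * (x * p\<^sup>2))
      + (2268 * (x ^ 3 * p + x ^ 5) + 5 * (x\<^sup>2 * p\<^sup>2))
      + (250 * (x ^ 5 + x ^ 4 * p) + 5 * (x ^ 3 * p\<^sup>2))"
  proof -
    have "\<bar>- a - b - c - d - e\<bar> \<le> A + B + C + D + F"
      if "\<bar>a\<bar> \<le> A" "\<bar>b\<bar> \<le> B" "\<bar>c\<bar> \<le> C" "\<bar>d\<bar> \<le> D" "\<bar>e\<bar> \<le> F" for a b c d e A B C D F :: real
      using that unfolding abs_le_iff by linarith
    from this[OF main T1 T2 T3 T4] show ?thesis unfolding eq .
  qed
  also have "\<dots> \<le> 80000 * (x ^ 5 + x ^ 3 * p + x * p\<^sup>2 + p ^ 3)"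
  proof -
    have "2 * e + (30000 * (a + b + e) + 100 * b + 102 * f + 8 * d')
        + (40000 * (a + e + c) + 5 * b) + (2268 * (a + e) + 5 * c)
        + (250 * (e + a') + 5 * b') \<le> 80000 * (e + a + b + f)"
      if "a' \<le> a" "b' \<le> b" "c \<le> b / 100" "d' \<le> b" "0 \<le> e" "0 \<le> a" "0 \<le> b" "0 \<le> f" "0 \<le> c"
      for a a' b b' c d' e f :: real
      using that by argo
    from this[OF small pos] show ?thesis .
  qed
  finally show ?thesis .
qed

lemma edge_expansion:
  assumes uv: "u \<noteq> v" "u < n" "v < n"
  shows "\<bar>(1 - R {{u, v}}) - (x - 5 / 2 * x\<^sup>2 + 49 / 6 * x ^ 3 - 243 / 8 * x ^ 4 - x * p + 7 * x\<^sup>2 * p - 2 * p\<^sup>2)\<bar>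
    \<le> 160600 * (x ^ 5 + x ^ 3 * p + x * p\<^sup>2 + p ^ 3)"
  using edge_equation_solution[OF x_nonneg x_small p_nonneg p_small, of "1 - R {{u, v}}" 80000]
    edge_equation[OF uv] R_nonneg[of "{{u, v}}"] R_le_1[of "{{u, v}}"] by simp

end

section \<open>Integration over the edge probability\<close>

text \<open>Dividing by 1 - p cancels -xp and turns 7 x^2 p into 9/2 x^2 p. Replacing
  \<open>n choose 2\<close> by n^2 / 2 adds n x / 2 = n^2 p^2 / 2 in leading order, which turns
  -2p^2 into -3p^2.\<close>

lemma (in sparse) log_derivative_bound:
  assumes n: "2 \<le> n"
  shows "\<bar>real (n choose 2) * (R {{0, 1}} - 1) / (1 - p) + (real n)\<^sup>2 / 2 *
      (x - 5 / 2 * x\<^sup>2 + 49 / 6 * x ^ 3 - 243 / 8 * x ^ 4 + 9 / 2 * x\<^sup>2 * p - 3 * p\<^sup>2)\<bar>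
    \<le> 200000 * ((real n)\<^sup>2 * (x ^ 5 + x ^ 3 * p + x * p\<^sup>2 + p ^ 3)) + x"
proof -
  define err where "err = x ^ 5 + x ^ 3 * p + x * p\<^sup>2 + p ^ 3"
  define s where "s = 1 - R {{0, 1}}"
  define \<sigma> where "\<sigma> = x - 5 / 2 * x\<^sup>2 + 49 / 6 * x ^ 3 - 243 / 8 * x ^ 4 + 9 / 2 * x\<^sup>2 * p - 2 * p\<^sup>2"
  define k where "k = real (n choose 2)"
  have k: "k = real n * (real n - 1) / 2"
    unfolding k_def using n by (simp add: choose_two real_of_nat_div of_nat_diff)
  have k_le: "0 \<le> k" "k \<le> (real n)\<^sup>2 / 2" using n unfolding k by (auto simp: power2_eq_square)
  have nx: "real n * x = (real n)\<^sup>2 * p\<^sup>2" by (simp add: x_def power2_eq_square)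
  define a where "a = x - 5 / 2 * x\<^sup>2 + 49 / 6 * x ^ 3 - 243 / 8 * x ^ 4 - x * p + 7 * x\<^sup>2 * p - 2 * p\<^sup>2"
  have s: "\<bar>s - a\<bar> \<le> 160600 * err"
    unfolding s_def err_def a_def using edge_expansion[of 0 1] n by simp
  have a\<sigma>: "a - (1 - p) * \<sigma> = 49 / 6 * (x ^ 3 * p) - 243 / 8 * (x ^ 4 * p) + 9 / 2 * (x\<^sup>2 * p\<^sup>2) - 2 * p ^ 3"
    unfolding \<sigma>_def a_def by (simp add: field_simps eval_nat_numeral)
  have small: "x ^ 4 * p \<le> x ^ 3 * p" "x\<^sup>2 * p\<^sup>2 \<le> x * p\<^sup>2"
    using x_nonneg x_small p_nonneg power_decreasing[of 3 4 x] power_decreasing[of 1 2 x]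
    by (auto intro!: mult_right_mono)
  have pos: "0 \<le> x ^ 5" "0 \<le> x ^ 3 * p" "0 \<le> x * p\<^sup>2" "0 \<le> p ^ 3" "0 \<le> x ^ 4 * p" "0 \<le> x\<^sup>2 * p\<^sup>2"
    using x_nonneg p_nonneg by auto
  have "\<bar>49 / 6 * b - 243 / 8 * b' + 9 / 2 * c' - 2 * d\<bar> \<le> 50 * (e + b + c + d)"
    if "b' \<le> b" "c' \<le> c" "0 \<le> e" "0 \<le> b" "0 \<le> c" "0 \<le> d" "0 \<le> b'" "0 \<le> c'" for b b' c c' d e :: real
    using that unfolding abs_le_iff by argo
  from this[OF small pos] have "\<bar>a - (1 - p) * \<sigma>\<bar> \<le> 50 * err" unfolding a\<sigma> err_def .
  with s have s\<sigma>: "\<bar>s - (1 - p) * \<sigma>\<bar> \<le> 160650 * err" by linarith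
  have err0: "0 \<le> err" unfolding err_def using x_nonneg p_nonneg by simp
  have div: "s / (1 - p) - \<sigma> = (s - (1 - p) * \<sigma>) / (1 - p)" using p_small by (simp add: field_simps)
  have "\<bar>s / (1 - p) - \<sigma>\<bar> \<le> (160650 * err) / (1 / 2)"
    unfolding div abs_divide using s\<sigma> p_small err0 by (intro frac_le) auto
  then have "\<bar>s / (1 - p) - \<sigma>\<bar> \<le> 321300 * err" by simp
  then have 1: "\<bar>k * (s / (1 - p) - \<sigma>)\<bar> \<le> (real n)\<^sup>2 / 2 * (321300 * err)"
    unfolding abs_mult using k_le by (intro mult_mono) auto
  \<comment> \<open>Only the leading term x of \<sigma> matters against the factor n / 2. Of the
    remainder, n x^2 equals n^2 x p^2 and fits into the error, while n / 2 times 2 p^2 is the extra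
    x in the bound.\<close>
  have "\<bar>\<sigma> - x\<bar> \<le> 3 * x\<^sup>2 + 2 * p\<^sup>2"
  proof -
    have "x ^ 3 \<le> x\<^sup>2 / 100" "x ^ 4 \<le> x ^ 3 / 100" "x\<^sup>2 * p \<le> x\<^sup>2 / 100"
      using mult_right_mono[OF x_small, of "x\<^sup>2"] mult_right_mono[OF x_small, of "x ^ 3"]
        mult_left_mono[OF p_small, of "x\<^sup>2"] x_nonneg by (auto simp: eval_nat_numeral)
    moreover have "0 \<le> x\<^sup>2" "0 \<le> x ^ 3" "0 \<le> x ^ 4" "0 \<le> x\<^sup>2 * p" "0 \<le> p\<^sup>2" using x_nonneg p_nonneg by auto
    ultimately show ?thesis unfolding \<sigma>_def by linarith
  qed
  then have "\<bar>real n / 2 * (\<sigma> - x)\<bar> \<le> real n / 2 * (3 * x\<^sup>2 + 2 * p\<^sup>2)"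
    unfolding abs_mult by (intro mult_mono) auto
  also have "\<dots> = 3 / 2 * (x * (real n * x)) + x"
    by (simp add: x_def field_simps power2_eq_square)
  also have "x * (real n * x) = (real n)\<^sup>2 * (x * p\<^sup>2)" unfolding nx by simp
  also have "\<dots> \<le> (real n)\<^sup>2 * err"
    unfolding err_def using x_nonneg p_nonneg by (intro mult_left_mono) auto
  finally have 2: "\<bar>real n / 2 * (\<sigma> - x)\<bar> \<le> 3 / 2 * ((real n)\<^sup>2 * err) + x" by simp
  have eq: "k * (R {{0, 1}} - 1) / (1 - p) + (real n)\<^sup>2 / 2 * (\<sigma> - p\<^sup>2) =
      - (k * (s / (1 - p) - \<sigma>)) + real n / 2 * (\<sigma> - x)"
  proof -
    have "real n / 2 * (\<sigma> - x) = real n / 2 * \<sigma> - (real n)\<^sup>2 * p\<^sup>2 / 2"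
      unfolding nx[symmetric] by (simp add: right_diff_distrib)
    moreover have "k * \<sigma> = (real n)\<^sup>2 / 2 * \<sigma> - real n / 2 * \<sigma>" unfolding k by (simp add: field_simps power2_eq_square)
    moreover have "k * (R {{0, 1}} - 1) / (1 - p) = - (k * (s / (1 - p)))"
      unfolding s_def by (simp add: field_simps minus_divide_left)
    ultimately show ?thesis by (simp add: algebra_simps)
  qed
  have \<sigma>': "x - 5 / 2 * x\<^sup>2 + 49 / 6 * x ^ 3 - 243 / 8 * x ^ 4 + 9 / 2 * x\<^sup>2 * p - 3 * p\<^sup>2 = \<sigma> - p\<^sup>2"
    unfolding \<sigma>_def by simp
  have "\<bar>- b + c\<bar> \<le> 200000 * (d * err) + y"
    if "\<bar>b\<bar> \<le> d / 2 * (321300 * err)" "\<bar>c\<bar> \<le> 3 / 2 * (d * err) + y" "0 \<le> d * err" for b c d y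
    using that by (simp add: abs_le_iff)
  from this[OF 1 2] show ?thesis
    unfolding k_def[symmetric] err_def[symmetric] \<sigma>' eq using err0 by simp
qed

definition log_poly :: "nat \<Rightarrow> real \<Rightarrow> real" where
  "log_poly n t = - (1 / 6) * real n ^ 3 * t ^ 3
             + (1 / 4) * real n ^ 4 * t ^ 5
             - (7 / 12) * real n ^ 5 * t ^ 7
             + (1 / 2) * real n ^ 2 * t ^ 3
             - (3 / 8) * real n ^ 4 * t ^ 6
             + (27 / 16) * real n ^ 6 * t ^ 9"

lemma has_derivative_log_poly:
  fixes n :: nat and t :: real
  defines "y \<equiv> real n * t\<^sup>2"
  shows "(log_poly n has_real_derivative - ((real n)\<^sup>2 / 2 *
      (y - 5 / 2 * y\<^sup>2 + 49 / 6 * y ^ 3 - 243 / 8 * y ^ 4 + 9 / 2 * y\<^sup>2 * t - 3 * t\<^sup>2))) (at t)"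
  unfolding log_poly_def[abs_def] y_def
  by (auto intro!: derivative_eq_intros simp: field_simps eval_nat_numeral)

lemma tf_prob_0: "tf_prob n 0 {} = 1"
proof -
  let ?E = "all_edges {..<n}"
  have "tf_prob n 0 {} = (\<Sum>S\<in>{{}}. 0 ^ card S * (1 - 0) ^ card (?E - S) * of_bool (triangle_free (S \<union> {})))"
    unfolding tf_prob_def bern_sum_def
    by (intro sum.mono_neutral_right) (auto simp: card_gt_0_iff intro: finite_subset)
  then show ?thesis by simp
qed

text \<open>Both functions vanish at p = 0, so integration reduces to the mean value theorem: the
  derivative bound \<open>B\<close> is increasing, whence an error of at most p * B p. The factor
  n^2 p turns x^5, x^3 p, x p^2 and p^3 into the four monomials shown.\<close>

lemma log_tf_prob_approx:
  assumes n: "2 \<le> n" and p: "0 \<le> p" "p \<le> 1 / 100" "real n * p\<^sup>2 \<le> 1 / 100"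
  shows "\<bar>ln (tf_prob n p {}) - log_poly n p\<bar> \<le>
    200000 * (real n ^ 7 * p ^ 11 + real n ^ 5 * p ^ 8 + real n ^ 3 * p ^ 5 + real n ^ 2 * p ^ 4)
    + real n ^ 1 * p ^ 3"
proof -
  define L where "L t = ln (tf_prob n t {}) - log_poly n t" for t
  define D where "D t = 1 / tf_prob n t {} * (real (n choose 2) * (tf_prob n t {{0, 1}} - tf_prob n t {}) / (1 - t))
    - - ((real n)\<^sup>2 / 2 * (real n * t\<^sup>2 - 5 / 2 * (real n * t\<^sup>2)\<^sup>2 + 49 / 6 * (real n * t\<^sup>2) ^ 3
      - 243 / 8 * (real n * t\<^sup>2) ^ 4 + 9 / 2 * (real n * t\<^sup>2)\<^sup>2 * t - 3 * t\<^sup>2))" for t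
  define B where "B t = 200000 * ((real n)\<^sup>2 * ((real n * t\<^sup>2) ^ 5 + (real n * t\<^sup>2) ^ 3 * t
    + (real n * t\<^sup>2) * t\<^sup>2 + t ^ 3)) + real n * t\<^sup>2" for t
  have L0: "L 0 = 0" by (simp add: L_def tf_prob_0 log_poly_def)
  have pos: "0 < tf_prob n t {}" if "0 \<le> t" "t \<le> p" for t using that p by (intro tf_prob_empty_pos) auto
  have der: "(L has_real_derivative D t) (at t)" if t: "0 \<le> t" "t \<le> p" for t
  proof -
    have "((\<lambda>t. ln (tf_prob n t {})) has_real_derivative 1 / tf_prob n t {} *
        (real (n choose 2) * (tf_prob n t {{0, 1}} - tf_prob n t {}) / (1 - t))) (at t)"
      by (rule DERIV_chain2[OF DERIV_ln_divide[OF pos[OF t]] has_derivative_tf_prob]) (use n t p in auto)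
    from DERIV_diff[OF this has_derivative_log_poly[of n]] show ?thesis
      unfolding L_def D_def .
  qed
  have bnd: "\<bar>D t\<bar> \<le> B p" if t: "0 \<le> t" "t \<le> p" for t
  proof -
    have le: "real n * t\<^sup>2 \<le> real n * p\<^sup>2" using t by (intro mult_left_mono power_mono) auto
    \<comment> \<open>The local expansion is needed at every intermediate probability
      \<open>t\<close>, and the hypotheses pass down from \<open>p\<close>.\<close>
    interpret sparse n t
      by unfold_locales (use t p le in auto)
    have "1 / tf_prob n t {} * (real (n choose 2) * (tf_prob n t {{0, 1}} - tf_prob n t {}) / (1 - t)) =
        real (n choose 2) * (R {{0, 1}} - 1) / (1 - t)"
      unfolding R_def using pos[OF t] by (simp add: diff_divide_distrib right_diff_distrib)
    then have "D t = real (n choose 2) * (R {{0, 1}} - 1) / (1 - t) + (real n)\<^sup>2 / 2 *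
      (x - 5 / 2 * x\<^sup>2 + 49 / 6 * x ^ 3 - 243 / 8 * x ^ 4 + 9 / 2 * x\<^sup>2 * t - 3 * t\<^sup>2)"
      unfolding D_def x_def by simp
    then have "\<bar>D t\<bar> \<le> B t" using log_derivative_bound[OF n] unfolding B_def x_def by simp
    also have "B t \<le> B p"
      unfolding B_def using t p le by (intro add_mono mult_left_mono mult_mono power_mono) auto
    finally show ?thesis .
  qed
  have "\<bar>L p\<bar> \<le> p * B p"
  proof (cases "p = 0")
    case False
    then obtain z where z: "0 < z" "z < p" "L p - L 0 = (p - 0) * D z"
      using MVT2[of 0 p L D] p der by auto
    then have "\<bar>L p\<bar> = p * \<bar>D z\<bar>" using L0 p by (simp add: abs_mult)
    also have "\<dots> \<le> p * B p" using z p by (intro mult_left_mono bnd) auto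
    finally show ?thesis .
  qed (simp add: L0)
  also have "p * B p = 200000 * (real n ^ 7 * p ^ 11 + real n ^ 5 * p ^ 8 + real n ^ 3 * p ^ 5 + real n ^ 2 * p ^ 4)
    + real n ^ 1 * p ^ 3"
  proof -
    have "p * ((real n)\<^sup>2 * (real n * p\<^sup>2) ^ 5) = real n ^ 7 * p ^ 11"
      "p * ((real n)\<^sup>2 * ((real n * p\<^sup>2) ^ 3 * p)) = real n ^ 5 * p ^ 8"
      "p * ((real n)\<^sup>2 * ((real n * p\<^sup>2) * p\<^sup>2)) = real n ^ 3 * p ^ 5"
      "p * ((real n)\<^sup>2 * p ^ 3) = real n ^ 2 * p ^ 4" "p * (real n * p\<^sup>2) = real n ^ 1 * p ^ 3"
      by (simp_all add: eval_nat_numeral)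
    then show ?thesis unfolding B_def by (simp only: distrib_left mult.left_commute[of p 200000])
  qed
  finally show ?thesis by (simp only: L_def)
qed

text \<open>The second condition says that n^a (n^(-7/11))^b is bounded, and \<open>b > 0\<close>
  lets the little-o survive. Equality holds for n^7 p^11, so this monomial fixes the exponent
  7/11.\<close>

lemma monomial_tendsto_0:
  fixes p :: "nat \<Rightarrow> real"
  assumes p: "p \<in> o(\<lambda>n. real n powr (- 7 / 11))" and b: "0 < b" "11 * a \<le> 7 * b"
  shows "(\<lambda>n. real n ^ a * p n ^ b) \<longlonglongrightarrow> 0"
proof -
  have "(\<lambda>n. real n ^ a * p n ^ b) \<in> o(\<lambda>n. real n ^ a * (real n powr (- 7 / 11)) ^ b)"
    by (intro landau_o.big_small_mult landau_o.small_power p b) auto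
  also have "(\<lambda>n. real n ^ a * (real n powr (- 7 / 11)) ^ b) \<in> O(\<lambda>_. 1)"
  proof (rule bigoI[where c = 1])
    show "\<forall>\<^sub>F n in at_top. norm (real n ^ a * (real n powr (- 7 / 11)) ^ b) \<le> 1 * norm (1 :: real)"
      using eventually_ge_at_top[of 1]
    proof eventually_elim
      case (elim n)
      have "real n ^ a = real n powr real a" using elim by (simp add: powr_realpow)
      moreover have "(real n powr (- 7 / 11)) ^ b = real n powr (real b * (- 7 / 11))"
        using powr_realpow[of "real n powr (- 7 / 11)" b] elim by (simp add: powr_powr mult.commute)
      ultimately have "real n ^ a * (real n powr (- 7 / 11)) ^ b = real n powr (real a + real b * (- 7 / 11))"
        by (simp only: powr_add)
      also have "\<dots> \<le> real n powr 0"
        using elim b by (intro powr_mono) (auto simp: field_simps)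
      finally show ?case using elim by simp
    qed
  qed
  finally show ?thesis by (auto dest: smalloD_tendsto)
qed

theorem theorem1p2:
  fixes p :: "nat \<Rightarrow> real"
  assumes "\<And>n. 0 \<le> p n \<and> p n \<le> 1"
    and "p \<in> o(\<lambda>n. real n powr (- 7 / 11))"
  shows "(\<lambda>n. measure_pmf.prob (random_graph n (p n)) {G. \<not> contains_triangle G})
    \<sim>[at_top]
    (\<lambda>n. exp (- (1 / 6) * real n ^ 3 * p n ^ 3
             + (1 / 4) * real n ^ 4 * p n ^ 5
             - (7 / 12) * real n ^ 5 * p n ^ 7
             + (1 / 2) * real n ^ 2 * p n ^ 3
             - (3 / 8) * real n ^ 4 * p n ^ 6
             + (27 / 16) * real n ^ 6 * p n ^ 9))"
proof -
  let ?P = "\<lambda>n. measure_pmf.prob (random_graph n (p n)) {G. \<not> contains_triangle G}"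
  let ?B = "\<lambda>n. 200000 * (real n ^ 7 * p n ^ 11 + real n ^ 5 * p n ^ 8 + real n ^ 3 * p n ^ 5 + real n ^ 2 * p n ^ 4)
    + real n ^ 1 * p n ^ 3"
  note lim = monomial_tendsto_0[OF assms(2)]
  have P: "?P n = tf_prob n (p n) {}" for n
    using prob_triangle_free[of "p n" n] assms(1)[of n] by (simp add: tf_prob_def)
  have B0: "?B \<longlonglongrightarrow> 200000 * (0 + 0 + 0 + 0) + 0"
    by (intro tendsto_add tendsto_mult tendsto_const lim) auto
  \<comment> \<open>p and n p^2 are themselves monomials covered by \<open>lim\<close>, so the
    locale hypotheses hold eventually.\<close>
  have ev: "\<forall>\<^sub>F n in at_top. 2 \<le> n \<and> p n \<le> 1 / 100 \<and> real n * (p n)\<^sup>2 \<le> 1 / 100"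
  proof -
    have "\<forall>\<^sub>F n in at_top. real n ^ 0 * p n ^ 1 < 1 / 100" "\<forall>\<^sub>F n in at_top. real n ^ 1 * p n ^ 2 < 1 / 100"
      by (rule order_tendstoD(2)[OF lim]; simp)+
    then show ?thesis using eventually_ge_at_top[of 2] by eventually_elim auto
  qed
  have "(\<lambda>n. ln (?P n) - log_poly n (p n)) \<longlonglongrightarrow> 0"
  proof (rule Lim_null_comparison)
    show "\<forall>\<^sub>F n in at_top. norm (ln (?P n) - log_poly n (p n)) \<le> ?B n"
      using ev
    proof eventually_elim
      case (elim n)
      then show ?case unfolding P using log_tf_prob_approx[of n "p n"] assms(1)[of n] by simp
    qed
  qed (use B0 in simp)
  then have "(\<lambda>n. exp (ln (?P n) - log_poly n (p n))) \<longlonglongrightarrow> exp 0"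
    by (rule tendsto_exp)
  moreover have "\<forall>\<^sub>F n in at_top. exp (ln (?P n) - log_poly n (p n)) = ?P n / exp (log_poly n (p n))"
    using ev
  proof eventually_elim
    case (elim n)
    then have "0 < ?P n" unfolding P using assms(1)[of n] by (intro tf_prob_empty_pos) auto
    then show ?case by (simp add: exp_diff)
  qed
  ultimately have "(\<lambda>n. ?P n / exp (log_poly n (p n))) \<longlonglongrightarrow> exp 0"
    by (rule Lim_transform_eventually)
  then have "?P \<sim>[at_top] (\<lambda>n. exp (log_poly n (p n)))"
    by (intro asymp_equivI') simp
  then show ?thesis by (simp only: log_poly_def)
qed

end
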